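(* The pca $J_1$ is isomorphic to $\mathcal{K}_1[E]$.
   Context: Pcas. A partial applicative structure on a set $A$ is a partial map $A\times A\to A$, written $(a,b)\mapsto ab$; application associates to the left. $t\downarrow$ means $t$ is defined; $t\lesssim s$ means: if $s\downarrow$ then $t\downarrow$ and $t=s$. A pca is a partial applicative structure for which there are $\mathsf{k},\mathsf{s}\in A$ with, for all $a,b,c\in A$: $\mathsf{s}ab\downarrow$, $\mathsf{k}ab=a$, $\mathsf{s}abc\lesssim ac(bc)$. An applicative morphism $\gamma:A\to B$ of pcas is a relation with $\gamma(a)=\{b\in B: a\,\gamma\, b\}\neq\emptyset$ for all $a\in A$, for which there is $r\in B$ such that whenever $aa'\downarrow$ in $A$, then for all $b\in\gamma(a),b'\in\gamma(a')$ one has $rbb'\downarrow$ and $rbb'\in\gamma(aa')$. Composition is composition of relations, and the identity morphism is the identity relation. "Isomorphic" means isomorphic in the resulting category. $\mathcal{K}_1$ is the pca on $\mathbb{N}$ with application $nm\simeq\phi_n(m)$, $\phi_n$ being the $n$-th partial recursive function. The pca $A[F]$. Let $A$ be a pca. Fix in $A$ booleans $\mathsf{T},\mathsf{F}$ ($\mathsf{T}ab=a$, $\mathsf{F}ab=b$), a pairing combinator $\mathsf{p}$ with projections ($\mathsf{p}_0(\mathsf{p}ab)=a$, $\mathsf{p}_1(\mathsf{p}ab)=b$), and a standard coding of finite tuples $[u_0,\ldots,u_n]\in A$ (and an empty tuple $[\,]$) for which projections, concatenation $*$ and length are computable in $A$; write $u^{<i}=[u_0,\ldots,u_{i-1}]$.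 For a partial function $f:A\to A$ and $a,b\in A$, an $f$-dialogue between $a$ and $b$ is a (possibly empty) tuple $u=[u_0,\ldots,u_n]$ such that for each $i\le n$ there is $v_i$ with $a([b]*u^{<i})=\mathsf{p}\,\mathsf{F}\,v_i$, $f(v_i)$ defined and $f(v_i)=u_i$. Put $a\cdot^f b=c$ if there is an $f$-dialogue $u$ between $a$ and $b$ with $a([b]*u)=\mathsf{p}\,\mathsf{T}\,c$. $A[f]$ denotes the set $A$ with the application $\cdot^f$ (it is a pca). For a (partial) functional $F:A^A\to A$ define partial functions $f_\alpha:A\to A$ by transfinite recursion: $f_0=\emptyset$; $f_{\alpha+1}(a)=b$ iff there is a total $g:A\to A$ with $a\cdot^{f_\alpha}x=g(x)$ for all $x\in A$ and with $F(g)$ defined and equal to $b$; $f_\lambda=\bigcup_{\alpha<\lambda}f_\alpha$ for limit $\lambda$. These are compatible; put $f=\bigcup_\alpha f_\alpha$ and $A[F]:=A[f]$. The functional $E:\mathbb{N}^{\mathbb{N}}\to\mathbb{N}$ is $E(f)=0$ if $(\exists n)\, f(n)=0$, and $E(f)=1$ otherwise. $\mathcal{K}_1[E]$ is $A[F]$ for $A=\mathcal{K}_1$, $F=E$. Pitts' local operator $J:\mathcal{P}(\mathbb{N})\to\mathcal{P}(\mathbb{N})$. Let $\mathsf{p}rs$ also denote the (recursive) pairing of $r,s\in\mathbb{N}$ in $\mathcal{K}_1$. For $P,Q\subseteq\mathbb{N}$: $P\wedge Q=\{\mathsf{p}rs : r\in P,s\in Q\}$ and $P\to Q=\{a\in\mathbb{N}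 : \text{for all } b\in P,\ \phi_a(b)\downarrow\text{ and }\phi_a(b)\in Q\}$. Let $R(n)=\{m\in\mathbb{N} : m\ge n\}$. Then $$J(P)=\bigcap\Big\{Q\subseteq\mathbb{N} : \{0\}\wedge P\subseteq Q\text{ and }\{1\}\wedge\Big(\bigcup_{n\in\mathbb{N}}(R(n)\to Q)\Big)\subseteq Q\Big\}.$$ The pca $J_1$. For $n\neq m$ one has $J\{n\}\cap J\{m\}=\emptyset$. For $e\in\mathbb{N}$ let $\psi_e:\mathbb{N}\to\mathbb{N}$ be the partial function with $\psi_e(n)=m$ iff $\phi_e(n)$ is defined and $\phi_e(n)\in J\{m\}$. $J_1$ is the set $\mathbb{N}$ with the application $(e,n)\mapsto\psi_e(n)$ (it is a pca). *)

theory Defs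
  imports Main "HOL-Library.Nat_Bijection"
begin

section \<open>Partial combinatory algebras and applicative morphisms\<close>

text \<open>The underlying set of a partial applicative structure is the whole type \<open>'a\<close>.\<close>

type_synonym 'a pas = "'a \<Rightarrow> 'a \<Rightarrow> 'a option"

text \<open>Application of possibly undefined expressions is strict; a compound expression is built
  from \<^term>\<open>Some a\<close> and is undefined iff its value is \<^term>\<open>None\<close>.\<close>

definition app :: "'a option \<Rightarrow> 'a pas \<Rightarrow> 'a option \<Rightarrow> 'a option"
    ("(_ \<cdot>\<^bsub>_\<^esub> _)" [90, 0, 91] 90)
  where "x \<cdot>\<^bsub>A\<^esub> y = Option.bind x (\<lambda>a. Option.bind y (\<lambda>b. A a b))"

definition lesssim :: "'a option \<Rightarrow> 'a option \<Rightarrow> bool" (infix "\<lesssim>" 50)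
  where "t \<lesssim> s \<longleftrightarrow> (s \<noteq> None \<longrightarrow> t \<noteq> None \<and> t = s)"

definition is_pca :: "'a pas \<Rightarrow> bool"
  where "is_pca A \<longleftrightarrow> (\<exists>k s. \<forall>a b c.
           Some s \<cdot>\<^bsub>A\<^esub> Some a \<cdot>\<^bsub>A\<^esub> Some b \<noteq> None \<and>
           Some k \<cdot>\<^bsub>A\<^esub> Some a \<cdot>\<^bsub>A\<^esub> Some b = Some a \<and>
           Some s \<cdot>\<^bsub>A\<^esub> Some a \<cdot>\<^bsub>A\<^esub> Some b \<cdot>\<^bsub>A\<^esub> Some c
             \<lesssim> Some a \<cdot>\<^bsub>A\<^esub> Some c \<cdot>\<^bsub>A\<^esub> (Some b \<cdot>\<^bsub>A\<^esub> Some c))"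

definition applicative_morphism :: "'a pas \<Rightarrow> 'b pas \<Rightarrow> ('a \<times> 'b) set \<Rightarrow> bool"
  where "applicative_morphism A B \<gamma> \<longleftrightarrow>
           (\<forall>a. \<gamma> `` {a} \<noteq> {}) \<and>
           (\<exists>r. \<forall>a a' c. A a a' = Some c \<longrightarrow>
              (\<forall>b \<in> \<gamma> `` {a}. \<forall>b' \<in> \<gamma> `` {a'}.
                 \<exists>d \<in> \<gamma> `` {c}. Some r \<cdot>\<^bsub>B\<^esub> Some b \<cdot>\<^bsub>B\<^esub> Some b' = Some d))"

text \<open>Isomorphism in the category of pcas and applicative morphisms; being an object of this
  category is part of the notion.\<close>

definition pca_isomorphic :: "'a pas \<Rightarrow> 'b pas \<Rightarrow> bool"
  where "pca_isomorphic A B \<longleftrightarrow>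
           is_pca A \<and> is_pca B \<and>
           (\<exists>\<gamma> \<delta>. applicative_morphism A B \<gamma> \<and> applicative_morphism B A \<delta> \<and>
                  \<gamma> O \<delta> = Id \<and> \<delta> O \<gamma> = Id)"


section \<open>Booleans, pairing and tuples in a pca\<close>

record 'a combinators =
  truth :: 'a
  falsity :: 'a
  pairing :: 'a
  tuple :: "'a list \<Rightarrow> 'a"

text \<open>A numeral system in \<open>A\<close>, relative to the booleans \<open>t\<close> and \<open>f\<close>. It is needed to say that
  the length of a tuple and its projections are computable in \<open>A\<close>. Any two
  numeral systems in a pca are translated into each other by elements of the pca, so it does not
  matter which one is used.\<close>

definition numeral_system :: "'a pas \<Rightarrow> 'a \<Rightarrow> 'a \<Rightarrow> (nat \<Rightarrow> 'a) \<Rightarrow> bool"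
  where "numeral_system A t f num \<longleftrightarrow> (\<exists>sc pd zt. \<forall>n.
           Some sc \<cdot>\<^bsub>A\<^esub> Some (num n) = Some (num (Suc n)) \<and>
           Some pd \<cdot>\<^bsub>A\<^esub> Some (num (Suc n)) = Some (num n) \<and>
           Some zt \<cdot>\<^bsub>A\<^esub> Some (num 0) = Some t \<and>
           Some zt \<cdot>\<^bsub>A\<^esub> Some (num (Suc n)) = Some f)"

definition valid_combinators :: "'a pas \<Rightarrow> 'a combinators \<Rightarrow> bool"
  where "valid_combinators A C \<longleftrightarrow>
           (\<forall>a b. Some (truth C) \<cdot>\<^bsub>A\<^esub> Some a \<cdot>\<^bsub>A\<^esub> Some b = Some a) \<and>
           (\<forall>a b. Some (falsity C) \<cdot>\<^bsub>A\<^esub> Some a \<cdot>\<^bsub>A\<^esub> Some b = Some b) \<and>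
           (\<exists>p\<^sub>0 p\<^sub>1. \<forall>a b.
              Some p\<^sub>0 \<cdot>\<^bsub>A\<^esub> (Some (pairing C) \<cdot>\<^bsub>A\<^esub> Some a \<cdot>\<^bsub>A\<^esub> Some b) = Some a \<and>
              Some p\<^sub>1 \<cdot>\<^bsub>A\<^esub> (Some (pairing C) \<cdot>\<^bsub>A\<^esub> Some a \<cdot>\<^bsub>A\<^esub> Some b) = Some b) \<and>
           (\<exists>num sg len prj cat. numeral_system A (truth C) (falsity C) num \<and>
              (\<forall>a. Some sg \<cdot>\<^bsub>A\<^esub> Some a = Some (tuple C [a])) \<and>
              (\<forall>u. Some len \<cdot>\<^bsub>A\<^esub> Some (tuple C u) = Some (num (length u))) \<and>
              (\<forall>u. \<forall>i < length u.
                 Some prj \<cdot>\<^bsub>A\<^esub> Some (num i) \<cdot>\<^bsub>A\<^esub> Some (tuple C u) = Some (u ! i)) \<and>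
              (\<forall>u v. Some cat \<cdot>\<^bsub>A\<^esub> Some (tuple C u) \<cdot>\<^bsub>A\<^esub> Some (tuple C v)
                 = Some (tuple C (u @ v))))"


section \<open>The pcas \<open>A[f]\<close> and \<open>A[F]\<close>\<close>

text \<open>Partial functions occurring as oracles are represented by their graphs, and tuples by
  lists, so that \<open>u\<^sup><\<^sup>i\<close> is \<^term>\<open>take i u\<close>.\<close>

definition dialogue ::
    "'a pas \<Rightarrow> 'a combinators \<Rightarrow> ('a \<times> 'a) set \<Rightarrow> 'a \<Rightarrow> 'a \<Rightarrow> 'a list \<Rightarrow> bool"
  where "dialogue A C f a b u \<longleftrightarrow> (\<forall>i < length u. \<exists>v.
           A a (tuple C ([b] @ take i u))
             = Some (pairing C) \<cdot>\<^bsub>A\<^esub> Some (falsity C) \<cdot>\<^bsub>A\<^esub> Some v \<and>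
           (v, u ! i) \<in> f)"

definition oracle_result ::
    "'a pas \<Rightarrow> 'a combinators \<Rightarrow> ('a \<times> 'a) set \<Rightarrow> 'a \<Rightarrow> 'a \<Rightarrow> 'a \<Rightarrow> bool"
  where "oracle_result A C f a b c \<longleftrightarrow> (\<exists>u. dialogue A C f a b u \<and>
           A a (tuple C ([b] @ u)) = Some (pairing C) \<cdot>\<^bsub>A\<^esub> Some (truth C) \<cdot>\<^bsub>A\<^esub> Some c)"

text \<open>The partial function given by a single-valued relation.\<close>

definition the_unique :: "('a \<Rightarrow> bool) \<Rightarrow> 'a option"
  where "the_unique P = (if \<exists>!c. P c then Some (THE c. P c) else None)"

definition oracle_pas :: "'a pas \<Rightarrow> 'a combinators \<Rightarrow> ('a \<times> 'a) set \<Rightarrow> 'a pas"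
  where "oracle_pas A C f a b = the_unique (oracle_result A C f a b)"

text \<open>The successor step \<open>f\<^sub>\<alpha> \<mapsto> f\<^sub>\<alpha>\<^sub>+\<^sub>1\<close>.\<close>

definition functional_step ::
    "'a pas \<Rightarrow> 'a combinators \<Rightarrow> (('a \<Rightarrow> 'a) \<Rightarrow> 'a option) \<Rightarrow> ('a \<times> 'a) set \<Rightarrow> ('a \<times> 'a) set"
  where "functional_step A C F f =
           {(a, b). \<exists>g. (\<forall>x. oracle_result A C f a x (g x)) \<and> F g = Some b}"

text \<open>The ordinals indexing the recursion are the elements of a well-order of cardinality
  exceeding that of the set of all binary relations on \<open>'a\<close>. The union of the stages below is
  already closed under the successor step (lemma \<open>functional_oracle_fixpoint\<close>), so larger
  ordinals contribute nothing.\<close>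

definition stage_order :: "('a \<times> 'a) set set rel"
  where "stage_order = cardSuc (card_of (UNIV :: ('a \<times> 'a) set set))"

definition is_pred :: "'o rel \<Rightarrow> 'o \<Rightarrow> 'o \<Rightarrow> bool"
  where "is_pred r \<beta> \<alpha> \<longleftrightarrow> \<beta> \<in> underS r \<alpha> \<and> (\<forall>\<gamma> \<in> underS r \<alpha>. (\<gamma>, \<beta>) \<in> r)"

definition iteration_stage :: "'o rel \<Rightarrow> ('b set \<Rightarrow> 'b set) \<Rightarrow> 'o \<Rightarrow> 'b set"
  where "iteration_stage r h = wo_rel.worec r (\<lambda>g \<alpha>.
           if underS r \<alpha> = {} then {}
           else if \<exists>\<beta>. is_pred r \<beta> \<alpha> then h (g (THE \<beta>. is_pred r \<beta> \<alpha>))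
           else (\<Union>\<beta> \<in> underS r \<alpha>. g \<beta>))"

definition functional_oracle ::
    "'a pas \<Rightarrow> 'a combinators \<Rightarrow> (('a \<Rightarrow> 'a) \<Rightarrow> 'a option) \<Rightarrow> ('a \<times> 'a) set"
  where "functional_oracle A C F =
           (\<Union>\<alpha> \<in> Field (stage_order :: ('a \<times> 'a) set set rel).
              iteration_stage stage_order (functional_step A C F) \<alpha>)"

definition functional_pas ::
    "'a pas \<Rightarrow> 'a combinators \<Rightarrow> (('a \<Rightarrow> 'a) \<Rightarrow> 'a option) \<Rightarrow> 'a pas"
  where "functional_pas A C F = oracle_pas A C (functional_oracle A C F)"


subsection \<open>The recursion equations, and closure of the union of the stages\<close>

lemma is_pred_unique:
  assumes "Well_order r" "is_pred r \<beta> \<alpha>" "is_pred r \<beta>' \<alpha>"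
  shows "\<beta> = \<beta>'"
proof -
  have "antisym r"
    using assms(1) by (simp add: well_order_on_def linear_order_on_def partial_order_on_def)
  then show ?thesis using assms(2,3) unfolding is_pred_def antisym_def by blast
qed

lemma iteration_stage_unfold:
  assumes "Well_order r"
  shows "iteration_stage r h \<alpha> =
           (if underS r \<alpha> = {} then {}
            else if \<exists>\<beta>. is_pred r \<beta> \<alpha> then h (iteration_stage r h (THE \<beta>. is_pred r \<beta> \<alpha>))
            else (\<Union>\<beta> \<in> underS r \<alpha>. iteration_stage r h \<beta>))"
proof -
  have wr: "wo_rel r" using assms by (simp add: wo_rel_def)
  let ?H = "\<lambda>g \<alpha>. if underS r \<alpha> = {} then {}
           else if \<exists>\<beta>. is_pred r \<beta> \<alpha> then h (g (THE \<beta>. is_pred r \<beta> \<alpha>))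
           else (\<Union>\<beta> \<in> underS r \<alpha>. g \<beta>)"
  have "wo_rel.adm_wo r ?H"
    unfolding wo_rel.adm_wo_def[OF wr]
  proof (intro allI impI)
    fix f g :: "'a \<Rightarrow> 'b set" and x
    assume eq: "\<forall>y \<in> underS r x. f y = g y"
    have "f (THE \<beta>. is_pred r \<beta> x) = g (THE \<beta>. is_pred r \<beta> x)" if "is_pred r \<beta> x" for \<beta>
    proof -
      have "(THE \<beta>. is_pred r \<beta> x) = \<beta>"
        using is_pred_unique[OF assms] that by (intro the_equality) blast+
      then show ?thesis using that eq by (simp add: is_pred_def)
    qed
    then show "?H f x = ?H g x" using eq by auto
  qed
  from wo_rel.worec_fixpoint[OF wr this] show ?thesis
    unfolding iteration_stage_def by (rule fun_cong)
qed

lemma iteration_stage_zero: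
  "Well_order r \<Longrightarrow> underS r \<alpha> = {} \<Longrightarrow> iteration_stage r h \<alpha> = {}"
  by (simp add: iteration_stage_unfold)

lemma iteration_stage_succ:
  assumes "Well_order r" "is_pred r \<beta> \<alpha>"
  shows "iteration_stage r h \<alpha> = h (iteration_stage r h \<beta>)"
proof -
  have "(THE \<beta>. is_pred r \<beta> \<alpha>) = \<beta>"
    using is_pred_unique[OF assms(1)] assms(2) by (intro the_equality) blast+
  moreover have "underS r \<alpha> \<noteq> {}" using assms(2) by (auto simp: is_pred_def)
  ultimately show ?thesis
    using assms(2) iteration_stage_unfold[OF assms(1), of h \<alpha>] by auto
qed

lemma iteration_stage_limit:
  "Well_order r \<Longrightarrow> underS r \<alpha> \<noteq> {} \<Longrightarrow> \<nexists>\<beta>. is_pred r \<beta> \<alpha> \<Longrightarrow>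
     iteration_stage r h \<alpha> = (\<Union>\<beta> \<in> underS r \<alpha>. iteration_stage r h \<beta>)"
  using iteration_stage_unfold[of r h \<alpha>] by auto

lemma iteration_stage_chain:
  assumes wo: "Well_order r" and "mono h"
  shows "iteration_stage r h \<alpha> \<subseteq> h (iteration_stage r h \<alpha>) \<and>
         (\<forall>\<beta> \<in> underS r \<alpha>. h (iteration_stage r h \<beta>) \<subseteq> iteration_stage r h \<alpha>)"
proof -
  have wr: "wo_rel r" using wo by (simp add: wo_rel_def)
  let ?S = "iteration_stage r h"
  have mono: "X \<subseteq> Y \<Longrightarrow> h X \<subseteq> h Y" for X Y using \<open>mono h\<close> by (simp add: mono_def)
  show ?thesis
  proof (induction \<alpha> rule: wo_rel.well_order_induct[OF wr])
    case (1 \<alpha>)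
    have IH1: "?S \<beta> \<subseteq> h (?S \<beta>)" if "\<beta> \<in> underS r \<alpha>" for \<beta>
      using 1 that by (auto simp: underS_def)
    have IH2: "h (?S \<gamma>) \<subseteq> ?S \<beta>" if "\<beta> \<in> underS r \<alpha>" "\<gamma> \<in> underS r \<beta>" for \<beta> \<gamma>
      using 1 that by (auto simp: underS_def)
    consider (zero) "underS r \<alpha> = {}" | (succ) \<beta> where "is_pred r \<beta> \<alpha>"
      | (lim) "underS r \<alpha> \<noteq> {}" "\<nexists>\<beta>. is_pred r \<beta> \<alpha>" by blast
    then show ?case
    proof cases
      case zero
      then show ?thesis by (simp add: iteration_stage_zero[OF wo])
    next
      case succ
      note eq = iteration_stage_succ[OF wo succ, of h]
      have b: "\<beta> \<in> underS r \<alpha>" using succ by (simp add: is_pred_def)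
      have "h (?S \<gamma>) \<subseteq> ?S \<alpha>" if g: "\<gamma> \<in> underS r \<alpha>" for \<gamma>
      proof (cases "\<gamma> = \<beta>")
        case False
        then have "\<gamma> \<in> underS r \<beta>" using succ g by (auto simp: is_pred_def underS_def)
        then show ?thesis using IH2[OF b] IH1[OF b] eq by blast
      qed (simp add: eq)
      moreover have "?S \<alpha> \<subseteq> h (?S \<alpha>)" using mono[OF IH1[OF b]] eq by simp
      ultimately show ?thesis by blast
    next
      case lim
      note eq = iteration_stage_limit[OF wo lim, of h]
      have "h (?S \<gamma>) \<subseteq> ?S \<alpha>" if g: "\<gamma> \<in> underS r \<alpha>" for \<gamma>
      proof -
        obtain \<delta> where d: "\<delta> \<in> underS r \<alpha>" "(\<delta>, \<gamma>) \<notin> r" using lim g by (auto simp: is_pred_def)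
        moreover have "{\<gamma>, \<delta>} \<subseteq> Field r" using g d(1) by (auto simp: underS_def Field_def)
        ultimately have "\<gamma> \<in> underS r \<delta>"
          using wo_rel.cases_Total3[OF wr, of \<gamma> \<delta> "\<lambda>a b. (\<delta>, \<gamma>) \<in> r \<or> (\<gamma>, \<delta>) \<in> r - Id"] wo_rel.REFL[OF wr]
          by (auto simp: underS_def refl_on_def)
        then show ?thesis using IH2[OF d(1)] eq d(1) by blast
      qed
      moreover have "?S \<alpha> \<subseteq> h (?S \<alpha>)"
      proof
        fix x assume "x \<in> ?S \<alpha>"
        then obtain \<gamma> where g: "\<gamma> \<in> underS r \<alpha>" "x \<in> ?S \<gamma>" using eq by auto
        then have "x \<in> h (?S \<gamma>)" using IH1 by blast
        moreover have "?S \<gamma> \<subseteq> ?S \<alpha>" using g(1) eq by blast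
        ultimately show "x \<in> h (?S \<alpha>)" using mono by blast
      qed
      ultimately show ?thesis by blast
    qed
  qed
qed

lemma iteration_stage_least:
  assumes wo: "Well_order r" and "mono h" "h X \<subseteq> X"
  shows "iteration_stage r h \<alpha> \<subseteq> X"
proof -
  have wr: "wo_rel r" using wo by (simp add: wo_rel_def)
  show ?thesis
  proof (induction \<alpha> rule: wo_rel.well_order_induct[OF wr])
    case (1 \<alpha>)
    then have IH: "iteration_stage r h \<beta> \<subseteq> X" if "\<beta> \<in> underS r \<alpha>" for \<beta>
      using that by (auto simp: underS_def)
    consider (zero) "underS r \<alpha> = {}" | (succ) \<beta> where "is_pred r \<beta> \<alpha>"
      | (lim) "underS r \<alpha> \<noteq> {}" "\<nexists>\<beta>. is_pred r \<beta> \<alpha>" by blast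
    then show ?case
    proof cases
      case zero
      then show ?thesis by (simp add: iteration_stage_zero[OF wo])
    next
      case succ
      have "h (iteration_stage r h \<beta>) \<subseteq> h X"
        using IH succ \<open>mono h\<close> by (auto simp: is_pred_def mono_def)
      then show ?thesis using iteration_stage_succ[OF wo succ, of h] assms(3) by blast
    next
      case lim
      then show ?thesis using iteration_stage_limit[OF wo lim, of h] IH by blast
    qed
  qed
qed

lemma Well_order_stage_order: "Well_order stage_order"
  unfolding stage_order_def
  using cardSuc_Card_order[OF card_of_Card_order] card_order_on_def by blast

lemma stage_order_fixpoint:
  fixes h :: "('a \<times> 'a) set \<Rightarrow> ('a \<times> 'a) set"
  assumes "mono h"
  shows "\<exists>\<alpha> \<in> Field (stage_order :: ('a \<times> 'a) set set rel).
           h (iteration_stage stage_order h \<alpha>) = iteration_stage stage_order h \<alpha>"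
proof (rule ccontr)
  let ?r = "stage_order :: ('a \<times> 'a) set set rel"
  let ?S = "iteration_stage ?r h"
  note wo = Well_order_stage_order
  note chain = iteration_stage_chain[OF wo assms]
  assume "\<not> ?thesis"
  then have neq: "h (?S \<alpha>) \<noteq> ?S \<alpha>" if "\<alpha> \<in> Field ?r" for \<alpha> using that by blast
  have less: "?S \<alpha> \<noteq> ?S \<beta>" if "\<alpha> \<in> Field ?r" "\<alpha> \<in> underS ?r \<beta>" for \<alpha> \<beta>
    using neq[OF that(1)] chain[of \<alpha>] chain[of \<beta>] that(2) by blast
  have "inj_on ?S (Field ?r)"
  proof (rule inj_onI, rule ccontr)
    fix x y assume xy: "x \<in> Field ?r" "y \<in> Field ?r" "?S x = ?S y" "x \<noteq> y"
    have wr: "wo_rel ?r" using wo by (simp add: wo_rel_def)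
    have "(x, y) \<in> ?r \<or> (y, x) \<in> ?r" using wo_rel.TOTALS[OF wr] xy by blast
    then have "x \<in> underS ?r y \<or> y \<in> underS ?r x" using xy(4) by (auto simp: underS_def)
    then show False using less[of x y] less[of y x] xy by auto
  qed
  then have "(card_of (Field ?r), card_of (UNIV :: ('a \<times> 'a) set set)) \<in> ordLeq"
    using card_of_ordLeq[of "Field ?r" "UNIV :: ('a \<times> 'a) set set"] by blast
  moreover have "(card_of (Field ?r), ?r) \<in> ordIso"
    unfolding stage_order_def
    by (rule card_of_Field_ordIso) (rule cardSuc_Card_order[OF card_of_Card_order])
  moreover have "(card_of (UNIV :: ('a \<times> 'a) set set), ?r) \<in> ordLess"
    unfolding stage_order_def by (rule cardSuc_greater[OF card_of_Card_order])
  ultimately show False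
    using not_ordLess_ordLeq ordIso_symmetric ordLess_ordIso_trans by blast
qed

lemma mono_functional_step: "mono (functional_step A C F)"
  unfolding mono_def functional_step_def oracle_result_def dialogue_def by fast

lemma functional_oracle_fixpoint:
  fixes A :: "'a pas"
  shows "functional_step A C F (functional_oracle A C F) = functional_oracle A C F"
proof -
  let ?h = "functional_step A C F"
  obtain \<alpha> where a: "\<alpha> \<in> Field (stage_order :: ('a \<times> 'a) set set rel)"
      "?h (iteration_stage stage_order ?h \<alpha>) = iteration_stage stage_order ?h \<alpha>"
    using stage_order_fixpoint[OF mono_functional_step] by blast
  have "iteration_stage stage_order ?h \<beta> \<subseteq> iteration_stage stage_order ?h \<alpha>"
    for \<beta> :: "('a \<times> 'a) set set"
    by (rule iteration_stage_least[OF Well_order_stage_order mono_functional_step]) (simp add: a)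
  then have "functional_oracle A C F = iteration_stage stage_order ?h \<alpha>"
    unfolding functional_oracle_def using a(1) by blast
  then show ?thesis using a(2) by simp
qed


section \<open>Kleene's first model\<close>

text \<open>Partial recursive functions of one variable, generated from the constant zero function,
  the successor and the projections of the Cantor pairing \<^const>\<open>prod_encode\<close> by pairing,
  composition, primitive recursion with a parameter, and minimisation.\<close>

datatype prog =
    Zero | Succ | Fst | Snd
  | Pair prog prog | Comp prog prog | Prec prog prog | Mu prog

primrec run :: "prog \<Rightarrow> nat \<Rightarrow> nat option"
  where
    "run Zero = (\<lambda>n. Some 0)"
  | "run Succ = (\<lambda>n. Some (Suc n))"
  | "run Fst = (\<lambda>n. Some (fst (prod_decode n)))"
  | "run Snd = (\<lambda>n. Some (snd (prod_decode n)))"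
  | "run (Pair p q) =
       (\<lambda>n. Option.bind (run p n) (\<lambda>a. Option.bind (run q n) (\<lambda>b. Some (prod_encode (a, b)))))"
  | "run (Comp p q) = (\<lambda>n. Option.bind (run q n) (run p))"
  | "run (Prec p q) =
       (\<lambda>n. case prod_decode n of (a, m) \<Rightarrow>
          rec_nat (run p a)
            (\<lambda>k x. Option.bind x (\<lambda>b. run q (prod_encode (a, prod_encode (k, b))))) m)"
  | "run (Mu p) =
       (\<lambda>n. if \<exists>m. run p (prod_encode (n, m)) = Some 0 \<and>
                   (\<forall>k < m. run p (prod_encode (n, k)) \<noteq> None)
            then Some (LEAST m. run p (prod_encode (n, m)) = Some 0) else None)"

primrec index :: "prog \<Rightarrow> nat"
  where
    "index Zero = 0"
  | "index Succ = 1"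
  | "index Fst = 2"
  | "index Snd = 3"
  | "index (Pair p q) = 4 + 4 * prod_encode (index p, index q)"
  | "index (Comp p q) = 5 + 4 * prod_encode (index p, index q)"
  | "index (Prec p q) = 6 + 4 * prod_encode (index p, index q)"
  | "index (Mu p) = 7 + 4 * index p"

lemma bij_index: "bij index"
proof (rule bijI)
  have "index p = index q \<Longrightarrow> p = q" for p q
  proof (induction p arbitrary: q)
    case (Pair p1 p2) then show ?case by (cases q; simp; presburger?)
  next
    case (Comp p1 p2) then show ?case by (cases q; simp; presburger?)
  next
    case (Prec p1 p2) then show ?case by (cases q; simp; presburger?)
  next
    case (Mu p) then show ?case by (cases q; simp; presburger?)
  qed (case_tac [!] q, simp_all)
  then show "inj index" by (rule injI)
  have "n \<in> range index" for n
  proof (induction n rule: less_induct)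
    case (less n)
    show ?case
    proof (cases "n < 4")
      case True
      then have "n = index Zero \<or> n = index Succ \<or> n = index Fst \<or> n = index Snd"
        by simp linarith
      then show ?thesis by blast
    next
      case False
      define m where "m = (n - 4) div 4"
      obtain a b where ab: "m = prod_encode (a, b)"
        by (metis prod_decode_inverse surj_pair)
      have m: "m < n" using False by (simp add: m_def)
      have "a < n" "b < n"
        using le_prod_encode_1[of a b] le_prod_encode_2[of b a] m ab by linarith+
      then obtain p q p' where pq: "a = index p" "b = index q" "m = index p'"
        using less m by (metis rangeE)
      have "n = 4 + 4 * m \<or> n = 5 + 4 * m \<or> n = 6 + 4 * m \<or> n = 7 + 4 * m"
        using False unfolding m_def by presburger
      then have "n = index (Pair p q) \<or> n = index (Comp p q) \<or> n = index (Prec p q) \<or>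
                 n = index (Mu p')"
        using ab pq by auto
      then show ?thesis by blast
    qed
  qed
  then show "surj index" by blast
qed

definition phi :: "nat \<Rightarrow> nat \<Rightarrow> nat option"
  where "phi n = run (inv index n)"

definition K1 :: "nat pas"
  where "K1 n m = phi n m"

definition functional_E :: "(nat \<Rightarrow> nat) \<Rightarrow> nat"
  where "functional_E f = (if \<exists>n. f n = 0 then 0 else 1)"

definition K1_E :: "nat combinators \<Rightarrow> nat pas"
  where "K1_E C = functional_pas K1 C (\<lambda>g. Some (functional_E g))"


section \<open>Pitts' local operator and the pca \<open>J\<^sub>1\<close>\<close>

text \<open>The pairing on natural numbers is the one given by the pairing combinator of
  \<^const>\<open>K1\<close>.\<close>

definition conj_set :: "nat combinators \<Rightarrow> nat set \<Rightarrow> nat set \<Rightarrow> nat set"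
  where "conj_set C P Q =
           {x. \<exists>r \<in> P. \<exists>s \<in> Q. Some (pairing C) \<cdot>\<^bsub>K1\<^esub> Some r \<cdot>\<^bsub>K1\<^esub> Some s = Some x}"

definition imp_set :: "nat set \<Rightarrow> nat set \<Rightarrow> nat set"
  where "imp_set P Q = {a. \<forall>b \<in> P. \<exists>c \<in> Q. phi a b = Some c}"

definition pitts_J :: "nat combinators \<Rightarrow> nat set \<Rightarrow> nat set"
  where "pitts_J C P = \<Inter> {Q. conj_set C {0} P \<subseteq> Q \<and>
                              conj_set C {1} (\<Union>n. imp_set {m. m \<ge> n} Q) \<subseteq> Q}"

definition J1 :: "nat combinators \<Rightarrow> nat pas"
  where "J1 C e n = the_unique (\<lambda>m. \<exists>x. phi e n = Some x \<and> x \<in> pitts_J C {m})"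

end

theory Submission
  imports Defs
begin

text \<open>Both pcas live on the natural numbers, and the identity relation is an isomorphism: each of
  the two applications is simulated by the other, effectively in the index.

  \<^emph>\<open>From \<open>K1[E]\<close> to \<open>J1\<close>.\<close> An element of \<open>J {m}\<close> is a well-founded tree with results at its
  leaves, in which almost all children of a node lead to the result \<open>m\<close>. Such trees can be
  sequenced effectively (\<open>ex_binds\<close>), so a dialogue can be evaluated tree by tree, provided that
  queries can be answered by trees. The value \<open>E g\<close> is not computable, but it is the limit of the
  tests whether \<open>g\<close> has a zero below \<open>k\<close>, and a node whose \<open>k\<close>-th child makes the \<open>k\<close>-th test has
  the result \<open>E g\<close>. The set of queries answered correctly in this way is closed under the
  generation of the graph of queries and answers, hence contains it (\<open>ex_J_evaluation\<close>). Since
  \<open>J {m}\<close> and \<open>J {n}\<close> are disjoint for \<open>m \<noteq> n\<close>, it also follows that dialogues have unique results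
  (\<open>K1_E_eq_Some\<close>).

  \<^emph>\<open>From \<open>J1\<close> to \<open>K1[E]\<close>.\<close> The difficulty is to find \<open>m\<close> from an element of \<open>J {m}\<close>: the
  bound from which on the children of a node may be trusted is not given, and a functional can
  only be applied to total functions, while children below the bound may be undefined. But \<open>x\<close> is
  in \<open>J P\<close> iff a player wins an open game starting at \<open>x\<close>, hence iff no strategy of the opponent
  avoids losing forever (\<open>J_wins\<close>, \<open>not_J_avoids\<close>). Losing depends on a finite part of a strategy
  only, so this says that a certain decidable tree is well-founded (\<open>ex_value_bar\<close>). If \<open>x\<close> is in
  \<open>J {m}\<close>, then for every \<open>j\<close> it is in exactly one of \<open>J {i. i \<le> j}\<close> and \<open>J {i. j < i}\<close>. Of two
  trees, exactly one of which is well-founded, \<open>E\<close> recognises which one it is: two players extend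
  a branch in one tree each, by turns, until one of them is stuck; every play ends, and \<open>E\<close>
  evaluates this game backwards (\<open>compare_trees\<close>). The number \<open>m\<close> is the least \<open>j\<close> for which the
  first tree is well-founded (\<open>ex_K1_E_index\<close>).

  Sequencing also yields the substitution combinator of \<open>J1\<close>, and the two simulations carry it
  over to \<open>K1[E]\<close>. The programs that are needed are obtained from the parametrization and
  recursion theorems, which rest on a universal program.\<close>

section \<open>Computable functions between numbered types\<close>

text \<open>Bijective numberings allow computability to be stated for functions on pairs and lists, and
  to be proved by matching closure rules against the shape of a term.\<close>

class numbered =
  fixes enc :: "'a \<Rightarrow> nat"
  assumes bij_enc: "bij enc"
begin

definition dec :: "nat \<Rightarrow> 'a" where "dec = inv enc"

lemma dec_enc [simp]: "dec (enc x) = x"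
  using bij_enc by (simp add: dec_def bij_is_inj)

lemma enc_dec [simp]: "enc (dec n) = n"
  using bij_enc by (simp add: dec_def bij_is_surj surj_f_inv_f)

lemma enc_eq_iff [simp]: "enc x = enc y \<longleftrightarrow> x = y"
  using bij_enc by (metis dec_enc)

end

instantiation nat :: numbered
begin
definition enc_nat :: "nat \<Rightarrow> nat" where [simp]: "enc_nat n = n"
instance by standard (simp add: bij_def inj_def surj_def)
end

instantiation prod :: (numbered, numbered) numbered
begin
definition enc_prod :: "'a \<times> 'b \<Rightarrow> nat"
  where "enc_prod p = prod_encode (enc (fst p), enc (snd p))"
instance
proof
  have "enc = prod_encode \<circ> map_prod (enc :: 'a \<Rightarrow> nat) (enc :: 'b \<Rightarrow> nat)"
    by (simp add: fun_eq_iff enc_prod_def)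
  moreover have "bij (map_prod (enc :: 'a \<Rightarrow> nat) (enc :: 'b \<Rightarrow> nat))"
    by (intro bijI prod.inj_map map_prod_surj bij_is_inj[OF bij_enc] bij_is_surj[OF bij_enc])
  ultimately show "bij (enc :: 'a \<times> 'b \<Rightarrow> nat)"
    by (metis bij_comp bij_prod_encode)
qed
end

instantiation list :: (numbered) numbered
begin
definition enc_list :: "'a list \<Rightarrow> nat"
  where "enc_list xs = list_encode (map enc xs)"
instance
proof
  have "enc = list_encode \<circ> map (enc :: 'a \<Rightarrow> nat)"
    by (simp add: fun_eq_iff enc_list_def)
  moreover have "bij (map (enc :: 'a \<Rightarrow> nat))"
    by (intro o_bij[where g = "map dec"]) (simp_all add: fun_eq_iff comp_def)
  ultimately show "bij (enc :: 'a list \<Rightarrow> nat)"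
    by (metis bij_comp bij_list_encode)
qed
end

lemma dec_nat [simp]: "dec n = (n::nat)"
  by (metis dec_enc enc_nat_def)

lemma prod_decode_enc [simp]: "prod_decode (enc p) = (enc (fst p), enc (snd p))"
  by (simp add: enc_prod_def)

text \<open>The prefixes stand for partial computable, total computable and decidable.\<close>

definition pcomp :: "('a::numbered \<Rightarrow> 'b::numbered option) \<Rightarrow> bool"
  where "pcomp F \<longleftrightarrow> (\<exists>p. \<forall>x. run p (enc x) = map_option enc (F x))"

definition tcomp :: "('a::numbered \<Rightarrow> 'b::numbered) \<Rightarrow> bool"
  where "tcomp f \<longleftrightarrow> pcomp (\<lambda>x. Some (f x))"

definition dcomp :: "('a::numbered \<Rightarrow> bool) \<Rightarrow> bool"
  where "dcomp P \<longleftrightarrow> tcomp (\<lambda>x. of_bool (P x) :: nat)"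

lemma pcompI: "(\<And>x. run p (enc x) = map_option enc (F x)) \<Longrightarrow> pcomp F"
  unfolding pcomp_def by blast

lemma tcompI: "(\<And>x. run p (enc x) = Some (enc (f x))) \<Longrightarrow> tcomp f"
  unfolding tcomp_def by (rule pcompI[where p = p]) simp

lemma pcomp_Some: "tcomp f \<Longrightarrow> pcomp (\<lambda>x. Some (f x))"
  by (simp add: tcomp_def)

definition identity_prog :: prog where "identity_prog = Pair Fst Snd"

lemma run_identity_prog [simp]: "run identity_prog n = Some n"
  by (simp add: identity_prog_def)

primrec constant_prog :: "nat \<Rightarrow> prog"
  where
    "constant_prog 0 = Zero"
  | "constant_prog (Suc n) = Comp Succ (constant_prog n)"

lemma run_constant_prog [simp]: "run (constant_prog n) x = Some n"
  by (induction n) auto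

lemma tcomp_id: "tcomp (\<lambda>x. x)"
  by (rule tcompI[where p = identity_prog]) simp

lemma tcomp_const: "tcomp (\<lambda>x. c)"
  by (rule tcompI[where p = "constant_prog (enc c)"]) simp

text \<open>In the premise on \<open>G\<close> the bound variable has become a second component of the input. The
  closure rules for the other binding operators are stated in the same way.\<close>

lemma pcomp_bind:
  assumes "pcomp F" "pcomp (\<lambda>z. G (fst z) (snd z))"
  shows "pcomp (\<lambda>x. Option.bind (F x) (G x))"
proof -
  obtain p where p: "\<And>x. run p (enc x) = map_option enc (F x)" using assms(1) unfolding pcomp_def by blast
  obtain q where q: "\<And>x. run q (enc x) = map_option enc (G (fst x) (snd x))"
    using assms(2) unfolding pcomp_def by blast
  show ?thesis
  proof (rule pcompI[where p = "Comp q (Pair identity_prog p)"])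
    fix x
    have "run q (prod_encode (enc x, enc y)) = map_option enc (G x y)" for y
      using q[of "(x, y)"] by (simp add: enc_prod_def)
    then show "run (Comp q (Pair identity_prog p)) (enc x)
        = map_option enc (Option.bind (F x) (G x))"
      by (cases "F x") (simp_all add: p)
  qed
qed

lemma pcomp_comp:
  assumes "pcomp F" "tcomp f" shows "pcomp (\<lambda>x. F (f x))"
proof -
  obtain p where p: "\<And>x. run p (enc x) = map_option enc (F x)" using assms(1) unfolding pcomp_def by blast
  obtain q where q: "\<And>x. run q (enc x) = Some (enc (f x))" using assms(2) by (auto simp: tcomp_def pcomp_def)
  show ?thesis by (rule pcompI[where p = "Comp p q"]) (simp add: p q)
qed

lemma tcomp_comp: "tcomp g \<Longrightarrow> tcomp f \<Longrightarrow> tcomp (\<lambda>x. g (f x))"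
  unfolding tcomp_def[of g] tcomp_def[of "\<lambda>x. g (f x)"] by (rule pcomp_comp)

lemma dcomp_comp: "dcomp P \<Longrightarrow> tcomp f \<Longrightarrow> dcomp (\<lambda>x. P (f x))"
  unfolding dcomp_def by (rule tcomp_comp)

lemma tcomp_pair:
  assumes "tcomp f" "tcomp g" shows "tcomp (\<lambda>x. (f x, g x))"
proof -
  obtain p where p: "\<And>x. run p (enc x) = Some (enc (f x))" using assms(1) by (auto simp: tcomp_def pcomp_def)
  obtain q where q: "\<And>x. run q (enc x) = Some (enc (g x))" using assms(2) by (auto simp: tcomp_def pcomp_def)
  show ?thesis by (rule tcompI[where p = "Pair p q"]) (simp add: p q enc_prod_def)
qed

lemma pcomp_comp2:
  assumes "pcomp (\<lambda>z. F (fst z) (snd z))" "tcomp f" "tcomp g"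
  shows "pcomp (\<lambda>x. F (f x) (g x))"
  using pcomp_comp[OF assms(1) tcomp_pair[OF assms(2,3)]] by simp

lemma pcomp_comp3:
  assumes "pcomp (\<lambda>z. F (fst z) (fst (snd z)) (snd (snd z)))" "tcomp f" "tcomp g" "tcomp h"
  shows "pcomp (\<lambda>x. F (f x) (g x) (h x))"
  using pcomp_comp[OF assms(1) tcomp_pair[OF assms(2) tcomp_pair[OF assms(3,4)]]] by simp

lemma tcomp_comp2:
  assumes "tcomp (\<lambda>z. F (fst z) (snd z))" "tcomp f" "tcomp g"
  shows "tcomp (\<lambda>x. F (f x) (g x))"
  using tcomp_comp[OF assms(1) tcomp_pair[OF assms(2,3)]] by simp

lemma dcomp_comp2:
  assumes "dcomp (\<lambda>z. P (fst z) (snd z))" "tcomp f" "tcomp g"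
  shows "dcomp (\<lambda>x. P (f x) (g x))"
  using dcomp_comp[OF assms(1) tcomp_pair[OF assms(2,3)]] by simp

lemma tcomp_fst: "tcomp f \<Longrightarrow> tcomp (\<lambda>x. fst (f x))"
  by (rule tcomp_comp[where g = fst], rule tcompI[where p = Fst]) simp_all

lemma tcomp_snd: "tcomp f \<Longrightarrow> tcomp (\<lambda>x. snd (f x))"
  by (rule tcomp_comp[where g = snd], rule tcompI[where p = Snd]) simp_all

lemma tcomp_enc: "tcomp f \<Longrightarrow> tcomp (\<lambda>x. enc (f x))"
  by (rule tcomp_comp[where g = enc], rule tcompI[where p = identity_prog]) simp_all

lemma tcomp_dec: "tcomp f \<Longrightarrow> tcomp (\<lambda>x. dec (f x))"
  by (rule tcomp_comp[where g = dec], rule tcompI[where p = identity_prog]) simp_all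

lemma tcomp_Suc: "tcomp f \<Longrightarrow> tcomp (\<lambda>x. Suc (f x))"
  by (rule tcomp_comp[where g = Suc], rule tcompI[where p = Succ]) simp_all

lemma tcomp_prod_encode: "tcomp f \<Longrightarrow> tcomp (\<lambda>x. prod_encode (f x))"
  by (rule tcomp_comp[where g = prod_encode], rule tcompI[where p = identity_prog])
    (simp_all add: enc_prod_def)

lemma tcomp_prod_decode: "tcomp f \<Longrightarrow> tcomp (\<lambda>x. prod_decode (f x))"
  by (rule tcomp_comp[where g = prod_decode], rule tcompI[where p = identity_prog])
    (simp_all add: enc_prod_def)

lemma pcomp_rec:
  fixes F :: "'a::numbered \<Rightarrow> 'b::numbered option"
  assumes F: "pcomp F" and G: "pcomp (\<lambda>z. G (fst z) (fst (snd z)) (snd (snd z)))" and "tcomp h"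
  shows "pcomp (\<lambda>x. rec_nat (F x) (\<lambda>k r. Option.bind r (G x k)) (h x))"
proof -
  obtain p where p: "\<And>x. run p (enc x) = map_option enc (F x)" using F unfolding pcomp_def by blast
  obtain q where q: "\<And>z. run q (enc z) = map_option enc (G (fst z) (fst (snd z)) (snd (snd z)))"
    using G unfolding pcomp_def by blast
  obtain r where r: "\<And>x. run r (enc x) = Some (h x)" using assms(3) by (auto simp: tcomp_def pcomp_def)
  have q': "run q (prod_encode (enc x, prod_encode (k, enc b))) = map_option enc (G x k b)" for x k b
    using q[of "(x, k, b)"] by (simp add: enc_prod_def)
  show ?thesis
  proof (rule pcompI[where p = "Comp (Prec p q) (Pair identity_prog r)"])
    fix x
    have "rec_nat (run p (enc x))
           (\<lambda>k y. Option.bind y (\<lambda>b. run q (prod_encode (enc x, prod_encode (k, b))))) m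
        = map_option enc (rec_nat (F x) (\<lambda>k r. Option.bind r (G x k)) m)" for m
    proof (induction m)
      case (Suc m)
      then show ?case
        by (cases "rec_nat (F x) (\<lambda>k r. Option.bind r (G x k)) m") (simp_all add: q')
    qed (simp add: p)
    then show "run (Comp (Prec p q) (Pair identity_prog r)) (enc x)
        = map_option enc (rec_nat (F x) (\<lambda>k r. Option.bind r (G x k)) (h x))"
      by (simp add: r)
  qed
qed

lemma tcomp_rec:
  fixes f :: "'a::numbered \<Rightarrow> 'b::numbered"
  assumes "tcomp f" "tcomp (\<lambda>z. g (fst z) (fst (snd z)) (snd (snd z)))" "tcomp h"
  shows "tcomp (\<lambda>x. rec_nat (f x) (g x) (h x))"
proof -
  have "rec_nat (Some (f x)) (\<lambda>k r. Option.bind r (\<lambda>b. Some (g x k b))) m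
      = Some (rec_nat (f x) (g x) m)" for x m
    by (induction m) auto
  then show ?thesis
    using pcomp_rec[of "\<lambda>x. Some (f x)" "\<lambda>x k b. Some (g x k b)" h] assms
    unfolding tcomp_def[of f] tcomp_def[of "\<lambda>x. rec_nat (f x) (g x) (h x)"]
      tcomp_def[of "\<lambda>z. g (fst z) (fst (snd z)) (snd (snd z))"] by simp
qed

lemma tcomp_if:
  assumes "dcomp P" "tcomp f" "tcomp g"
  shows "tcomp (\<lambda>x. if P x then f x else g x)"
proof -
  have "(\<lambda>x. if P x then f x else g x) = (\<lambda>x. rec_nat (g x) (\<lambda>k r. f x) (of_bool (P x)))"
    by (auto simp: of_bool_def)
  then show ?thesis
    using assms unfolding dcomp_def
    by (auto intro!: tcomp_rec intro: tcomp_comp[OF _ tcomp_fst[OF tcomp_id]])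
qed

lemma dcomp_not:
  assumes "dcomp P" shows "dcomp (\<lambda>x. \<not> P x)"
proof -
  have "(\<lambda>x. of_bool (\<not> P x)) = (\<lambda>x. if P x then 0 else 1::nat)" by auto
  then show ?thesis unfolding dcomp_def by (simp only:) (intro tcomp_if assms tcomp_const)
qed

text \<open>Programs are strict and have no conditional. A primitive recursion with at most one step
  runs a computation under a guard; with \<open>F\<close> guarded by \<open>P\<close> and \<open>G\<close> by its negation, the branch
  that is not taken cannot make the whole diverge.\<close>

lemma pcomp_if:
  fixes F :: "'a::numbered \<Rightarrow> 'b::numbered option"
  assumes P: "dcomp P" and F: "pcomp F" and G: "pcomp G"
  shows "pcomp (\<lambda>x. if P x then F x else G x)"
proof -
  have guard: "pcomp (\<lambda>x. if Q x then H x else Some (dec 0))"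
    if Q: "dcomp Q" and H: "pcomp H" for Q :: "'a \<Rightarrow> bool" and H :: "'a \<Rightarrow> 'b option"
  proof -
    have "(\<lambda>x. if Q x then H x else Some (dec 0))
        = (\<lambda>x. rec_nat (Some (dec 0)) (\<lambda>k r. Option.bind r (\<lambda>b. H x)) (of_bool (Q x)))"
      by (auto simp: of_bool_def)
    moreover have "pcomp \<dots>"
      using that unfolding dcomp_def
      by (intro pcomp_rec) (auto intro: pcomp_Some tcomp_const pcomp_comp[OF _ tcomp_fst[OF tcomp_id]])
    ultimately show ?thesis by simp
  qed
  note notP = dcomp_not[OF P]
  have "(\<lambda>x. if P x then F x else G x) =
      (\<lambda>x. Option.bind (if P x then F x else Some (dec 0))
        (\<lambda>a. Option.bind (if \<not> P x then G x else Some (dec 0))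
          (\<lambda>b. Some (if P x then a else b))))"
    by (auto simp: fun_eq_iff)
  moreover have "pcomp \<dots>"
    by (intro pcomp_bind guard P F pcomp_Some tcomp_if dcomp_comp[OF P] pcomp_comp[OF guard[OF notP G]]
        tcomp_fst tcomp_snd tcomp_id)
  ultimately show ?thesis by simp
qed

lemma dcomp_conj:
  assumes "dcomp P" "dcomp Q" shows "dcomp (\<lambda>x. P x \<and> Q x)"
proof -
  have "(\<lambda>x. of_bool (P x \<and> Q x)) = (\<lambda>x. if P x then of_bool (Q x) else 0::nat)" by auto
  then show ?thesis using assms(2) unfolding dcomp_def
    by (simp only:) (intro tcomp_if assms tcomp_const)
qed

lemma tcomp_diff_1: "tcomp f \<Longrightarrow> tcomp (\<lambda>x. f x - 1 :: nat)"
proof (rule tcomp_comp[of "\<lambda>n. n - 1"])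
  have "n - 1 = rec_nat 0 (\<lambda>k r. k) n" for n by (cases n) auto
  then show "tcomp (\<lambda>n::nat. n - 1)"
    by (simp only:) (intro tcomp_rec tcomp_const tcomp_id tcomp_fst tcomp_snd)
qed

lemma tcomp_plus: "tcomp f \<Longrightarrow> tcomp g \<Longrightarrow> tcomp (\<lambda>x. f x + g x :: nat)"
proof -
  assume "tcomp f" "tcomp g"
  moreover have "m + n = rec_nat n (\<lambda>k r. Suc r) m" for m n by (induction m) auto
  ultimately show ?thesis
    by (simp only:) (intro tcomp_rec tcomp_Suc tcomp_id tcomp_fst tcomp_snd)
qed

lemma tcomp_minus:
  assumes "tcomp f" "tcomp g" shows "tcomp (\<lambda>x. f x - g x :: nat)"
proof -
  have "m - n = rec_nat m (\<lambda>k r. r - 1) n" for m n by (induction n) auto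
  then have "(\<lambda>x. f x - g x) = (\<lambda>x. rec_nat (f x) (\<lambda>k r. r - 1) (g x))" by blast
  then show ?thesis
    by (simp only:) (intro tcomp_rec tcomp_diff_1 tcomp_id tcomp_fst tcomp_snd assms)
qed

lemma tcomp_times: "tcomp f \<Longrightarrow> tcomp g \<Longrightarrow> tcomp (\<lambda>x. f x * g x :: nat)"
proof -
  assume fg: "tcomp f" "tcomp g"
  have "m * n = rec_nat 0 (\<lambda>k r. n + r) m" for m n by (induction m) auto
  then show ?thesis using fg
    by (simp only:)
      (intro tcomp_rec tcomp_plus tcomp_const tcomp_id tcomp_fst tcomp_snd tcomp_comp[OF fg(2)])
qed

lemma dcomp_zero: "tcomp f \<Longrightarrow> dcomp (\<lambda>x. f x = (0::nat))"
proof (rule dcomp_comp[of "\<lambda>n::nat. n = 0"])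
  have "(\<lambda>n. of_bool (n = 0)) = (\<lambda>n. rec_nat 1 (\<lambda>k r. 0) n :: nat)"
  proof
    fix n :: nat show "of_bool (n = 0) = (rec_nat 1 (\<lambda>k r. 0) n :: nat)" by (cases n) auto
  qed
  then show "dcomp (\<lambda>n::nat. n = 0)"
    unfolding dcomp_def by (simp only:) (intro tcomp_rec tcomp_const tcomp_id)
qed

lemma dcomp_le: "tcomp f \<Longrightarrow> tcomp g \<Longrightarrow> dcomp (\<lambda>x. f x \<le> (g x :: nat))"
  using dcomp_zero[OF tcomp_minus, of f g] by simp

lemma dcomp_eq:
  assumes "tcomp f" "tcomp g" shows "dcomp (\<lambda>x. f x = g x)"
proof -
  have "(\<lambda>x. f x = g x) = (\<lambda>x. enc (f x) \<le> enc (g x) \<and> enc (g x) \<le> enc (f x))"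
    by (simp add: eq_iff[symmetric])
  then show ?thesis by (simp only:) (intro dcomp_conj dcomp_le tcomp_enc assms)
qed

lemma dcomp_less: "tcomp f \<Longrightarrow> tcomp g \<Longrightarrow> dcomp (\<lambda>x. f x < (g x :: nat))"
  using dcomp_not[OF dcomp_le, of g f] by (simp add: not_le)

lemma pcomp_None: "pcomp (\<lambda>x. None)"
  by (rule pcompI[where p = "Mu Succ"]) simp

lemma pcomp_search:
  fixes P :: "'a::numbered \<Rightarrow> 'b::numbered \<Rightarrow> bool"
  assumes "dcomp (\<lambda>z. P (fst z) (snd z))"
  shows "pcomp (\<lambda>x. if \<exists>y. P x y then Some (dec (LEAST n. P x (dec n)) :: 'b) else None)"
proof -
  have "tcomp (\<lambda>z :: 'a \<times> 'b. if P (fst z) (snd z) then 0 else 1::nat)"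
    by (intro tcomp_if tcomp_const assms)
  then obtain p where
    p: "\<forall>z :: 'a \<times> 'b. run p (enc z) = map_option enc (Some (if P (fst z) (snd z) then 0 else 1::nat))"
    unfolding tcomp_def pcomp_def by blast
  have p': "run p (prod_encode (enc x, n)) = Some (if P x (dec n) then 0 else 1)" for x n
    using spec[OF p, of "(x, dec n)"] by (simp add: enc_prod_def)
  show ?thesis
  proof (rule pcompI[where p = "Mu p"])
    fix x
    have "(\<exists>n. P x (dec n)) \<longleftrightarrow> (\<exists>y. P x y)" by (metis dec_enc)
    then show "run (Mu p) (enc x)
        = map_option enc (if \<exists>y. P x y then Some (dec (LEAST n. P x (dec n)) :: 'b) else None)"
      by (simp add: p')
  qed
qed

lemma pcomp_the:
  fixes P :: "'a::numbered \<Rightarrow> 'b::numbered \<Rightarrow> bool"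
  assumes P: "dcomp (\<lambda>z. P (fst z) (snd z))" and "\<And>x y y'. P x y \<Longrightarrow> P x y' \<Longrightarrow> y = y'"
  shows "pcomp (\<lambda>x. if \<exists>y. P x y then Some (THE y. P x y) else None)"
proof -
  have eq: "(THE y. P x y) = dec (LEAST n. P x (dec n))" if "\<exists>y. P x y" for x
  proof (rule the_equality)
    from that obtain y where "P x y" by blast
    then have "P x (dec (enc y))" by simp
    then show "P x (dec (LEAST n. P x (dec n)))" by (rule LeastI[of "\<lambda>n. P x (dec n)"])
    then show "P x y \<Longrightarrow> y = dec (LEAST n. P x (dec n))" for y by (rule assms(2)[rotated])
  qed
  have "(\<lambda>x. if \<exists>y. P x y then Some (THE y. P x y) else None)
      = (\<lambda>x. if \<exists>y. P x y then Some (dec (LEAST n. P x (dec n))) else None)"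
    by (intro ext if_cong arg_cong[where f = Some] refl eq)
  then show ?thesis using pcomp_search[OF P] by (simp only:)
qed

lemma enc_Nil [simp]: "enc [] = 0"
  by (simp add: enc_list_def)

lemma enc_Cons [simp]: "enc (x # xs) = Suc (prod_encode (enc x, enc xs))"
  by (simp add: enc_list_def)

lemma dec_0_list: "dec 0 = []"
  by (metis dec_enc enc_Nil)

text \<open>The default makes \<open>head\<close> a projection of the code of the list: the code of the empty list is
  0, and both components of 0 as a pair are 0.\<close>

definition head :: "'a::numbered list \<Rightarrow> 'a"
  where "head xs = (case xs of [] \<Rightarrow> dec 0 | x # _ \<Rightarrow> x)"

lemma head_simps [simp]: "head [] = dec 0" "head (x # xs) = x" by (simp_all add: head_def)

lemma prod_decode_0: "prod_decode 0 = (0, 0)"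
  using prod_encode_inverse[of "(0, 0)"] by (simp add: prod_encode_def)

lemma tcomp_head:
  fixes f :: "'a::numbered \<Rightarrow> 'b::numbered list"
  assumes "tcomp f" shows "tcomp (\<lambda>x. head (f x))"
proof -
  have "head xs = dec (fst (prod_decode (enc xs - 1)))" for xs :: "'b list"
    by (cases xs) (auto simp: prod_decode_0)
  then show ?thesis
    by (simp only:) (intro tcomp_dec tcomp_fst tcomp_prod_decode tcomp_diff_1 tcomp_enc assms)
qed

lemma tcomp_tl:
  fixes f :: "'a::numbered \<Rightarrow> 'b::numbered list"
  assumes "tcomp f" shows "tcomp (\<lambda>x. tl (f x))"
proof -
  have "tl xs = dec (snd (prod_decode (enc xs - 1)))" for xs :: "'b list"
    by (cases xs) (simp_all add: prod_decode_0 dec_0_list)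
  then show ?thesis
    by (simp only:) (intro tcomp_dec tcomp_snd tcomp_prod_decode tcomp_diff_1 tcomp_enc assms)
qed

lemma tcomp_Cons:
  assumes "tcomp f" "tcomp g" shows "tcomp (\<lambda>x. f x # g x)"
proof -
  have "y # ys = dec (Suc (prod_encode (enc y, enc ys)))" for y :: 'b and ys
    by (metis dec_enc enc_Cons)
  then show ?thesis using assms
    by (simp only:) (intro tcomp_dec tcomp_Suc tcomp_prod_encode tcomp_pair tcomp_enc)
qed

lemma dcomp_Nil: "tcomp f \<Longrightarrow> dcomp (\<lambda>x. f x = [])"
  by (intro dcomp_eq tcomp_const)

lemma length_le_enc: "length xs \<le> enc xs"
proof (induction xs)
  case (Cons x xs)
  then show ?case using le_prod_encode_2[of "enc xs" "enc x"] by simp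
qed simp

definition pfold :: "('s \<Rightarrow> 'b \<Rightarrow> 's option) \<Rightarrow> 's option \<Rightarrow> 'b list \<Rightarrow> 's option"
  where "pfold G = foldl (\<lambda>r y. Option.bind r (\<lambda>s. G s y))"

lemma pfold_simps [simp]:
  "pfold G r [] = r"
  "pfold G r (y # ys) = pfold G (Option.bind r (\<lambda>s. G s y)) ys"
  "pfold G r (ys @ zs) = pfold G (pfold G r ys) zs"
  by (simp_all add: pfold_def)

lemma pfold_None [simp]: "pfold G None ys = None"
  by (induction ys) auto

text \<open>The code of a list bounds its length, so the fold is a primitive recursion that consumes the
  list and stands still once the list is empty.\<close>

lemma pcomp_pfold:
  fixes F :: "'a::numbered \<Rightarrow> 's::numbered option" and h :: "'a \<Rightarrow> 'b::numbered list"
  assumes F: "pcomp F" and G: "pcomp (\<lambda>z. G (fst z) (fst (snd z)) (snd (snd z)))" and h: "tcomp h"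
  shows "pcomp (\<lambda>x. pfold (G x) (F x) (h x))"
proof -
  define step where "step x k z =
      (if snd z = [] then Some z
       else Option.bind (G x (fst z) (head (snd z))) (\<lambda>s. Some (s, tl (snd z))))"
    for x and k :: nat and z :: "'s \<times> 'b list"
  define init where "init x = Option.bind (F x) (\<lambda>s. Some (s, h x))" for x
  have finished: "rec_nat (Some (s, [])) (\<lambda>k r. Option.bind r (step x k)) m = Some (s, [])" for x s m
    by (induction m) (simp_all add: step_def)
  have shift: "rec_nat r (\<lambda>k r. Option.bind r (step x k)) (Suc m)
      = rec_nat (Option.bind r (step x 0)) (\<lambda>k r. Option.bind r (step x k)) m" for x r m
    by (induction m) (simp_all add: step_def)
  have none: "rec_nat None (\<lambda>k r. Option.bind r (step x k)) m = None" for x m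
    by (induction m) simp_all
  have fold: "rec_nat (Some (s, ys)) (\<lambda>k r. Option.bind r (step x k)) m
      = map_option (\<lambda>s. (s, [])) (pfold (G x) (Some s) ys)" if "length ys \<le> m" for x s ys m
    using that
  proof (induction ys arbitrary: s m)
    case (Cons y ys)
    then obtain m' where m: "m = Suc m'" "length ys \<le> m'" by (cases m) auto
    then show ?case using Cons.IH unfolding m shift
      by (cases "G x s y") (simp_all add: none step_def[of _ 0])
  qed (simp add: finished)
  have "(\<lambda>x. pfold (G x) (F x) (h x)) =
      (\<lambda>x. Option.bind (rec_nat (init x) (\<lambda>k r. Option.bind r (step x k)) (enc (h x)))
        (\<lambda>z. Some (fst z)))"
  proof
    fix x
    show "pfold (G x) (F x) (h x) =
      Option.bind (rec_nat (init x) (\<lambda>k r. Option.bind r (step x k)) (enc (h x)))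
        (\<lambda>z. Some (fst z))"
    proof (cases "F x")
      case (Some s)
      then show ?thesis
        using fold[where x = x and s = s, OF length_le_enc[of "h x"]]
        by (cases "pfold (G x) (Some s) (h x)") (simp_all add: init_def)
    qed (simp add: init_def none)
  qed
  moreover have "pcomp \<dots>"
    unfolding init_def step_def
    by (intro pcomp_bind pcomp_rec pcomp_Some tcomp_fst tcomp_snd tcomp_id pcomp_if dcomp_Nil F
        tcomp_pair tcomp_tl tcomp_head tcomp_enc h tcomp_comp[OF h]
        pcomp_comp3[OF G])
  ultimately show ?thesis by simp
qed

lemmas comp_intros =
  tcomp_id tcomp_const tcomp_pair tcomp_fst tcomp_snd tcomp_Suc tcomp_plus tcomp_minus
  tcomp_prod_encode tcomp_prod_decode tcomp_head tcomp_tl tcomp_Cons tcomp_rec tcomp_if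
  dcomp_conj dcomp_not dcomp_le dcomp_less dcomp_eq
  pcomp_Some pcomp_None pcomp_bind pcomp_if

section \<open>A universal program\<close>

text \<open>\<^const>\<open>phi\<close> is computed by a stack machine. A state \<open>(mode, c, x, K)\<close> either evaluates
  the program with index \<open>c\<close> at \<open>x\<close> (mode 0) or returns the value \<open>x\<close> to the stack \<open>K\<close> (mode 1,
  with \<open>c = 0\<close>). A frame \<open>(tag, c, a, k, m)\<close> holds what remains to be done with a returned value.
  Tags 0 and 4 belong to \<^const>\<open>Pair\<close>: the second program \<open>c\<close> is still to be evaluated at \<open>a\<close>,
  or the value \<open>a\<close> of the first one is waiting to be paired. Tag 5 belongs to \<^const>\<open>Comp\<close>, tag
  2 to \<^const>\<open>Prec\<close> with \<open>k\<close> steps made and \<open>m\<close> steps to go, and tag 3 to \<^const>\<open>Mu\<close> with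
  candidate \<open>k\<close>.\<close>

type_synonym frame = "nat \<times> nat \<times> nat \<times> nat \<times> nat"
type_synonym state = "nat \<times> nat \<times> nat \<times> frame list"

abbreviation (input) eval_state :: "nat \<Rightarrow> nat \<Rightarrow> frame list \<Rightarrow> state"
  where "eval_state c x K \<equiv> (0, c, x, K)"

abbreviation (input) ret_state :: "nat \<Rightarrow> frame list \<Rightarrow> state"
  where "ret_state y K \<equiv> (Suc 0, 0, y, K)"

definition eval_step :: "nat \<Rightarrow> nat \<Rightarrow> frame list \<Rightarrow> state"
  where "eval_step c x K = (let args = (c - 4) div 4; p = fst (prod_decode args); q = snd (prod_decode args) in
     if c = 0 then ret_state 0 K
     else if c = 1 then ret_state (Suc x) K
     else if c = 2 then ret_state (fst (prod_decode x)) K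
     else if c = 3 then ret_state (snd (prod_decode x)) K
     else if c mod 4 = 0 then eval_state p x ((0, q, x, 0, 0) # K)
     else if c mod 4 = 1 then eval_state q x ((5, p, 0, 0, 0) # K)
     else if c mod 4 = 2 then
       eval_state p (fst (prod_decode x)) ((2, q, fst (prod_decode x), 0, snd (prod_decode x)) # K)
     else eval_state args (prod_encode (x, 0)) ((3, args, x, 0, 0) # K))"

definition ret_step :: "nat \<Rightarrow> frame \<Rightarrow> frame list \<Rightarrow> state"
  where "ret_step y fr K = (let tag = fst fr; c = fst (snd fr); a = fst (snd (snd fr));
       k = fst (snd (snd (snd fr))); m = snd (snd (snd (snd fr))) in
     if tag = 0 then eval_state c a ((4, 0, y, 0, 0) # K)
     else if tag = 5 then eval_state c y K
     else if tag = 2 then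
       (if m = 0 then ret_state y K
        else eval_state c (prod_encode (a, prod_encode (k, y))) ((2, c, a, Suc k, m - 1) # K))
     else if tag = 3 then
       (if y = 0 then ret_state k K
        else eval_state c (prod_encode (a, Suc k)) ((3, c, a, Suc k, 0) # K))
     else ret_state (prod_encode (a, y)) K)"

definition step :: "state \<Rightarrow> state"
  where "step s = (let x = fst (snd (snd s)); K = snd (snd (snd s)) in
     if fst s = 0 then eval_step (fst (snd s)) x K
     else if K = [] then s else ret_step x (head K) (tl K))"

lemma step_eval:
  "step (eval_state (index Zero) x K) = ret_state 0 K"
  "step (eval_state (index Succ) x K) = ret_state (Suc x) K"
  "step (eval_state (index Fst) x K) = ret_state (fst (prod_decode x)) K"
  "step (eval_state (index Snd) x K) = ret_state (snd (prod_decode x)) K"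
  "step (eval_state (index (Pair p q)) x K) = eval_state (index p) x ((0, index q, x, 0, 0) # K)"
  "step (eval_state (index (Comp p q)) x K) = eval_state (index q) x ((5, index p, 0, 0, 0) # K)"
  "step (eval_state (index (Prec p q)) (prod_encode (a, m)) K)
     = eval_state (index p) a ((2, index q, a, 0, m) # K)"
  "step (eval_state (index (Mu p)) x K)
     = eval_state (index p) (prod_encode (x, 0)) ((3, index p, x, 0, 0) # K)"
proof -
  have arith: "(5 + 4 * m - 4) div 4 = m" "(6 + 4 * m - 4) div 4 = m" "(7 + 4 * m - 4) div 4 = m"
    "Suc (4 * m) div 4 = m" "Suc (Suc (4 * m)) div 4 = m"
    "(4 + 4 * m) mod 4 = 0" "(5 + 4 * m) mod 4 = 1" "(6 + 4 * m) mod 4 = 2" "(7 + 4 * m) mod 4 = 3"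
    for m :: nat by presburger+
  show "step (eval_state (index Zero) x K) = ret_state 0 K"
    "step (eval_state (index Succ) x K) = ret_state (Suc x) K"
    "step (eval_state (index Fst) x K) = ret_state (fst (prod_decode x)) K"
    "step (eval_state (index Snd) x K) = ret_state (snd (prod_decode x)) K"
    "step (eval_state (index (Pair p q)) x K) = eval_state (index p) x ((0, index q, x, 0, 0) # K)"
    "step (eval_state (index (Comp p q)) x K) = eval_state (index q) x ((5, index p, 0, 0, 0) # K)"
    "step (eval_state (index (Prec p q)) (prod_encode (a, m)) K)
     = eval_state (index p) a ((2, index q, a, 0, m) # K)"
    "step (eval_state (index (Mu p)) x K)
     = eval_state (index p) (prod_encode (x, 0)) ((3, index p, x, 0, 0) # K)"
    unfolding step_def eval_step_def Let_def index.simps by (simp_all add: arith)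
qed

lemma step_ret:
  "step (ret_state y []) = ret_state y []"
  "step (ret_state y ((0, c, x, k, m) # K)) = eval_state c x ((4, 0, y, 0, 0) # K)"
  "step (ret_state y ((4, c, x, k, m) # K)) = ret_state (prod_encode (x, y)) K"
  "step (ret_state y ((5, c, x, k, m) # K)) = eval_state c y K"
  "step (ret_state y ((2, c, a, k, 0) # K)) = ret_state y K"
  "step (ret_state y ((2, c, a, k, Suc m) # K))
     = eval_state c (prod_encode (a, prod_encode (k, y))) ((2, c, a, Suc k, m) # K)"
  "step (ret_state 0 ((3, c, a, k, m) # K)) = ret_state k K"
  "step (ret_state (Suc y) ((3, c, a, k, m) # K))
     = eval_state c (prod_encode (a, Suc k)) ((3, c, a, Suc k, 0) # K)"
  by (simp_all add: step_def ret_step_def)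

lemma run_Mu_Some:
  "run (Mu p) n = Some m \<longleftrightarrow>
     run p (prod_encode (n, m)) = Some 0 \<and> (\<forall>k < m. \<exists>v. run p (prod_encode (n, k)) = Some (Suc v))"
    (is "_ \<longleftrightarrow> ?R m")
proof -
  let ?Q = "\<lambda>m. run p (prod_encode (n, m)) = Some 0"
  have least: "(LEAST m. ?Q m) = m" if "?R m" for m
    using that by (intro Least_equality) (auto simp: not_less[symmetric])
  show ?thesis
  proof
    assume r: "run (Mu p) n = Some m"
    then have ex: "\<exists>m. ?Q m \<and> (\<forall>k<m. run p (prod_encode (n, k)) \<noteq> None)" and m: "m = (LEAST m. ?Q m)"
      by (auto split: if_splits)
    then obtain m' where m': "?Q m'" "\<forall>k<m'. run p (prod_encode (n, k)) \<noteq> None" by blast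
    have "?Q m" unfolding m using m'(1) by (rule LeastI)
    moreover have "\<exists>v. run p (prod_encode (n, k)) = Some (Suc v)" if "k < m" for k
    proof -
      have "k < m'" using that m Least_le[of ?Q, OF m'(1)] by simp
      then obtain w where w: "run p (prod_encode (n, k)) = Some w" using m'(2) by blast
      moreover have "w \<noteq> 0" using not_less_Least[of k ?Q] that m w by auto
      ultimately show ?thesis by (cases w) auto
    qed
    ultimately show "?R m" by blast
  next
    assume R: "?R m"
    then have "\<exists>m. ?Q m \<and> (\<forall>k<m. run p (prod_encode (n, k)) \<noteq> None)" by (intro exI[of _ m]) auto
    then show "run (Mu p) n = Some m" using least[OF R] by simp
  qed
qed

definition reaches :: "state \<Rightarrow> state \<Rightarrow> bool"
  where "reaches s t \<longleftrightarrow> (\<exists>n. (step ^^ n) s = t)"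

lemma reaches_refl: "reaches s s"
  unfolding reaches_def by (rule exI[of _ 0]) simp

lemma reaches_step: "reaches (step s) t \<Longrightarrow> reaches s t"
  unfolding reaches_def by (metis funpow_Suc_right o_apply)

lemma reaches_trans: "reaches s t \<Longrightarrow> reaches t u \<Longrightarrow> reaches s u"
  unfolding reaches_def by (metis funpow_add o_apply)

text \<open>The stack is arbitrary because subprograms run on top of the frames of the program that
  calls them.\<close>

lemma machine_complete:
  "run p x = Some y \<Longrightarrow> reaches (eval_state (index p) x K) (ret_state y K)"
proof (induction p arbitrary: x y K)
  case (Pair p q)
  from Pair.prems obtain a b where ab: "run p x = Some a" "run q x = Some b" "y = prod_encode (a, b)"
    by (auto simp: bind_eq_Some_conv)
  have "reaches (ret_state b ((4, 0, a, 0, 0) # K)) (ret_state y K)"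
    by - (rule reaches_step, simp add: step_ret reaches_refl ab(3))
  then have "reaches (ret_state a ((0, index q, x, 0, 0) # K)) (ret_state y K)"
    by - (rule reaches_step, simp add: step_ret reaches_trans[OF Pair.IH(2)[OF ab(2)]])
  then show ?case
    by - (rule reaches_step, simp add: step_eval reaches_trans[OF Pair.IH(1)[OF ab(1)]] del: index.simps)
next
  case (Comp p q)
  from Comp.prems obtain a where a: "run q x = Some a" "run p a = Some y"
    by (auto simp: bind_eq_Some_conv)
  have "reaches (ret_state a ((5, index p, 0, 0, 0) # K)) (ret_state y K)"
    by - (rule reaches_step, simp add: step_ret Comp.IH(1)[OF a(2)])
  then show ?case
    by - (rule reaches_step, simp add: step_eval reaches_trans[OF Comp.IH(2)[OF a(1)]] del: index.simps)
next
  case (Prec p q)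
  obtain a m where x: "x = prod_encode (a, m)" by (metis prod_decode_inverse surj_pair)
  let ?R = "rec_nat (run p a)
            (\<lambda>k z. Option.bind z (\<lambda>b. run q (prod_encode (a, prod_encode (k, b)))))"
  have loop: "reaches (ret_state b ((2, index q, a, k, m) # K)) (ret_state y K)"
    if "?R k = Some b" "?R (k + m) = Some y" for k m b
    using that
  proof (induction m arbitrary: k b)
    case 0
    then have "b = y" by simp
    then show ?case by (simp add: reaches_step step_ret reaches_refl)
  next
    case (Suc m)
    have prefix: "?R (j + i) = None" if "?R j = None" for i j using that by (induction i) auto
    obtain b' where b': "?R (Suc k) = Some b'"
      using prefix[of "Suc k" m] Suc.prems(2) by (cases "?R (Suc k)") auto
    then have "run q (prod_encode (a, prod_encode (k, b))) = Some b'" using Suc.prems(1) by simp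
    moreover have "reaches (ret_state b' ((2, index q, a, Suc k, m) # K)) (ret_state y K)"
      using Suc.IH[OF b'] Suc.prems(2) by simp
    ultimately show ?case
      by - (rule reaches_step, simp add: step_ret reaches_trans[OF Prec.IH(2)])
  qed
  have y: "?R m = Some y" using Prec.prems x by simp
  have prefix: "?R (0 + i) = None" if "?R 0 = None" for i using that by (induction i) auto
  obtain b where b: "?R 0 = Some b" using prefix[of m] y by (cases "?R 0") auto
  then have "run p a = Some b" by simp
  moreover have "reaches (ret_state b ((2, index q, a, 0, m) # K)) (ret_state y K)"
    using loop[OF b] y by simp
  ultimately show ?case
    by - (rule reaches_step, simp add: x step_eval reaches_trans[OF Prec.IH(1)] del: index.simps)
next
  case (Mu p)
  then have y: "run p (prod_encode (x, y)) = Some 0"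
    "\<And>k. k < y \<Longrightarrow> \<exists>v. run p (prod_encode (x, k)) = Some (Suc v)"
    by (auto simp: run_Mu_Some simp del: run.simps)
  have loop: "reaches (eval_state (index p) (prod_encode (x, k)) ((3, index p, x, k, 0) # K)) (ret_state y K)"
    if "k + d = y" for k d
    using that
  proof (induction d arbitrary: k)
    case 0
    have "reaches (ret_state 0 ((3, index p, x, y, 0) # K)) (ret_state y K)"
      by - (rule reaches_step, simp add: step_ret reaches_refl)
    with Mu.IH[OF y(1)] 0 show ?case by (auto intro: reaches_trans)
  next
    case (Suc d)
    then obtain v where v: "run p (prod_encode (x, k)) = Some (Suc v)" using y(2)[of k] by auto
    have "reaches (ret_state (Suc v) ((3, index p, x, k, 0) # K)) (ret_state y K)"
      by (rule reaches_step) (use Suc.IH[of "Suc k"] Suc.prems in \<open>simp add: step_ret\<close>)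
    with Mu.IH[OF v] show ?case by (auto intro: reaches_trans)
  qed
  show ?case using loop[of 0 y] by - (rule reaches_step, simp add: step_eval del: index.simps)
qed (rule reaches_step, simp add: step_eval reaches_refl del: index.simps)+

definition halts :: "nat \<Rightarrow> state \<Rightarrow> bool"
  where "halts n s \<longleftrightarrow> (\<exists>v. (step ^^ n) s = ret_state v [])"

lemma halts_step:
  assumes "halts n s" "fst s = 0 \<or> snd (snd (snd s)) \<noteq> []"
  obtains n' where "n' < n" "halts n' (step s)"
proof (cases n)
  case 0
  then show ?thesis using assms by (auto simp: halts_def)
next
  case (Suc n')
  then show ?thesis using assms(1) that[of n'] by (auto simp: halts_def funpow_swap1)
qed

text \<open>A halting run that starts with an evaluation passes through the return of that evaluation.
  The strict decrease of the number of remaining steps replaces, for \<^const>\<open>Mu\<close>, an a priori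
  bound on the number of candidates that are tried.\<close>

lemma machine_sound:
  "halts n (eval_state (index p) x K) \<Longrightarrow> \<exists>y n'. n' < n \<and> run p x = Some y \<and> halts n' (ret_state y K)"
proof (induction p arbitrary: n x K)
  case (Pair p q)
  obtain n1 where n1: "n1 < n" "halts n1 (eval_state (index p) x ((0, index q, x, 0, 0) # K))"
    using Pair.prems by (rule halts_step) (auto simp: step_eval simp del: index.simps)
  obtain a n2 where n2: "n2 < n1" "run p x = Some a" "halts n2 (ret_state a ((0, index q, x, 0, 0) # K))"
    using Pair.IH(1)[OF n1(2)] by blast
  obtain n3 where n3: "n3 < n2" "halts n3 (eval_state (index q) x ((4, 0, a, 0, 0) # K))"
    using n2(3) by (rule halts_step) (auto simp: step_ret)
  obtain b n4 where n4: "n4 < n3" "run q x = Some b" "halts n4 (ret_state b ((4, 0, a, 0, 0) # K))"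
    using Pair.IH(2)[OF n3(2)] by blast
  obtain n5 where n5: "n5 < n4" "halts n5 (ret_state (prod_encode (a, b)) K)"
    using n4(3) by (rule halts_step) (auto simp: step_ret)
  have "n5 < n" using n1 n2 n3 n4 n5 by linarith
  then show ?case using n2 n4 n5 by auto
next
  case (Comp p q)
  obtain n1 where n1: "n1 < n" "halts n1 (eval_state (index q) x ((5, index p, 0, 0, 0) # K))"
    using Comp.prems by (rule halts_step) (auto simp: step_eval simp del: index.simps)
  obtain a n2 where n2: "n2 < n1" "run q x = Some a" "halts n2 (ret_state a ((5, index p, 0, 0, 0) # K))"
    using Comp.IH(2)[OF n1(2)] by blast
  obtain n3 where n3: "n3 < n2" "halts n3 (eval_state (index p) a K)"
    using n2(3) by (rule halts_step) (auto simp: step_ret)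
  obtain b n4 where n4: "n4 < n3" "run p a = Some b" "halts n4 (ret_state b K)"
    using Comp.IH(1)[OF n3(2)] by blast
  have "n4 < n" using n1 n2 n3 n4 by linarith
  then show ?case using n2 n4 by auto
next
  case (Prec p q)
  obtain a m where x: "x = prod_encode (a, m)" by (metis prod_decode_inverse surj_pair)
  let ?R = "rec_nat (run p a)
            (\<lambda>k z. Option.bind z (\<lambda>b. run q (prod_encode (a, prod_encode (k, b)))))"
  have loop: "\<exists>y n'. n' < n \<and> ?R (k + m) = Some y \<and> halts n' (ret_state y K)"
    if "halts n (ret_state b ((2, index q, a, k, m) # K))" "?R k = Some b" for n k m b
    using that
  proof (induction m arbitrary: n k b)
    case 0
    obtain n1 where "n1 < n" "halts n1 (ret_state b K)"
      using 0(1) by (rule halts_step) (auto simp: step_ret)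
    then show ?case using 0 by auto
  next
    case (Suc m)
    obtain n1 where n1: "n1 < n"
      "halts n1 (eval_state (index q) (prod_encode (a, prod_encode (k, b))) ((2, index q, a, Suc k, m) # K))"
      using Suc.prems(1) by (rule halts_step) (auto simp: step_ret)
    obtain b' n2 where n2: "n2 < n1" "run q (prod_encode (a, prod_encode (k, b))) = Some b'"
      "halts n2 (ret_state b' ((2, index q, a, Suc k, m) # K))"
      using Prec.IH(2)[OF n1(2)] by blast
    have "?R (Suc k) = Some b'" using Suc.prems(2) n2(2) by simp
    from Suc.IH[OF n2(3) this] show ?case
      using n1(1) n2(1) by (metis add_Suc_shift less_trans)
  qed
  obtain n1 where n1: "n1 < n" "halts n1 (eval_state (index p) a ((2, index q, a, 0, m) # K))"
    using Prec.prems unfolding x by (rule halts_step) (auto simp: step_eval simp del: index.simps)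
  obtain b n2 where n2: "n2 < n1" "run p a = Some b" "halts n2 (ret_state b ((2, index q, a, 0, m) # K))"
    using Prec.IH(1)[OF n1(2)] by blast
  have "?R 0 = Some b" using n2(2) by simp
  from loop[OF n2(3) this] obtain y n3 where "n3 < n2" "?R m = Some y" "halts n3 (ret_state y K)" by auto
  then show ?case using n1(1) n2(1) by (intro exI[of _ y] exI[of _ n3]) (simp add: x)
next
  case (Mu p)
  have loop: "\<exists>y n'. n' < n \<and> k \<le> y \<and> run p (prod_encode (x, y)) = Some 0 \<and>
      (\<forall>i. k \<le> i \<and> i < y \<longrightarrow> (\<exists>v. run p (prod_encode (x, i)) = Some (Suc v))) \<and> halts n' (ret_state y K)"
    if "halts n (eval_state (index p) (prod_encode (x, k)) ((3, index p, x, k, 0) # K))" for n k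
    using that
  proof (induction n arbitrary: k rule: less_induct)
    case (less n)
    obtain v n1 where n1: "n1 < n" "run p (prod_encode (x, k)) = Some v"
      "halts n1 (ret_state v ((3, index p, x, k, 0) # K))"
      using Mu.IH[OF less.prems] by blast
    show ?case
    proof (cases v)
      case 0
      obtain n2 where "n2 < n1" "halts n2 (ret_state k K)"
        using n1(3) unfolding 0 by (rule halts_step) (auto simp: step_ret)
      then show ?thesis using n1 0 by (intro exI[of _ k] exI[of _ n2]) auto
    next
      case (Suc v')
      obtain n2 where n2: "n2 < n1"
        "halts n2 (eval_state (index p) (prod_encode (x, Suc k)) ((3, index p, x, Suc k, 0) # K))"
        using n1(3) unfolding Suc by (rule halts_step) (auto simp: step_ret)
      then obtain y n3 where y: "n3 < n2" "Suc k \<le> y" "run p (prod_encode (x, y)) = Some 0"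
        "\<forall>i. Suc k \<le> i \<and> i < y \<longrightarrow> (\<exists>v. run p (prod_encode (x, i)) = Some (Suc v))"
        "halts n3 (ret_state y K)"
        using less.IH[of n2 "Suc k"] n1(1) by auto
      have "\<exists>v. run p (prod_encode (x, i)) = Some (Suc v)" if "k \<le> i" "i < y" for i
        using that y(4) n1(2) Suc by (cases "i = k") auto
      then show ?thesis using y n1(1) n2(1) by (intro exI[of _ y] exI[of _ n3]) auto
    qed
  qed
  obtain n1 where n1: "n1 < n"
    "halts n1 (eval_state (index p) (prod_encode (x, 0)) ((3, index p, x, 0, 0) # K))"
    using Mu.prems by (rule halts_step) (auto simp: step_eval simp del: index.simps)
  from loop[OF this(2)] obtain y n2 where "n2 < n1" "run (Mu p) x = Some y" "halts n2 (ret_state y K)"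
    by (auto simp: run_Mu_Some simp del: run.simps)
  then show ?case using n1(1) by (intro exI[of _ y] exI[of _ n2]) (auto simp del: run.simps)
qed (erule halts_step, simp, force simp: step_eval simp del: index.simps)+

definition computes_in :: "nat \<Rightarrow> nat \<Rightarrow> nat \<Rightarrow> nat \<Rightarrow> bool"
  where "computes_in t e x y \<longleftrightarrow> (step ^^ t) (eval_state e x []) = ret_state y []"

lemma phi_index: "phi (index p) = run p"
  using bij_index by (simp add: phi_def bij_is_inj)

lemma obtain_index:
  obtains p where "e = index p"
  using bij_index by (metis bij_is_surj surjD)

text \<open>The witness of this normal form is a number of steps. Final states are fixed by the machine,
  so two halting runs from the same state can be made equally long and then have the same result.\<close>

lemma phi_normal_form: "phi e x = Some y \<longleftrightarrow> (\<exists>t. computes_in t e x y)"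
proof -
  obtain p where p: "e = index p" by (rule obtain_index)
  have fix_ret: "(step ^^ n) (ret_state v []) = ret_state v []" for n v
    by (induction n) (simp_all add: step_ret)
  show ?thesis
  proof
    assume "phi e x = Some y"
    then show "\<exists>t. computes_in t e x y"
      using machine_complete[of p x y "[]"] by (simp add: p phi_index computes_in_def reaches_def)
  next
    assume "\<exists>t. computes_in t e x y"
    then obtain t where t: "(step ^^ t) (eval_state e x []) = ret_state y []" by (auto simp: computes_in_def)
    then have "halts t (eval_state (index p) x [])" by (simp add: halts_def p)
    from machine_sound[OF this] obtain z where z: "run p x = Some z" by blast
    then obtain t' where t': "(step ^^ t') (eval_state e x []) = ret_state z []"
      using machine_complete[of p x z "[]"] by (auto simp: p reaches_def)
    have "(step ^^ (t + t')) (eval_state e x []) = ret_state z []"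
      using t' fix_ret by (simp add: funpow_add)
    moreover have "(step ^^ (t' + t)) (eval_state e x []) = ret_state y []"
      using t fix_ret by (simp add: funpow_add)
    ultimately have "z = y" by (simp add: add.commute)
    then show "phi e x = Some y" using z by (simp add: p phi_index)
  qed
qed

text \<open>Division by 4 decodes indices.\<close>

lemma divmod_4:
  "rec_nat (0, 0) (\<lambda>k r. if snd r = 3 then (Suc (fst r), 0) else (fst r, Suc (snd r))) n
     = (n div 4, n mod 4)"
proof (induction n)
  case (Suc n)
  have "Suc n div 4 = (if n mod 4 = 3 then Suc (n div 4) else n div 4)"
    "Suc n mod 4 = (if n mod 4 = 3 then 0 else Suc (n mod 4))" by presburger+
  then show ?case using Suc by simp
qed simp

lemma tcomp_divmod_4: "tcomp (\<lambda>n. (n div 4, n mod 4) :: nat \<times> nat)"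
  unfolding divmod_4[symmetric] by (intro comp_intros)

lemma tcomp_div_4: "tcomp f \<Longrightarrow> tcomp (\<lambda>x. f x div 4 :: nat)"
  using tcomp_fst[OF tcomp_comp[OF tcomp_divmod_4]] by simp

lemma tcomp_mod_4: "tcomp f \<Longrightarrow> tcomp (\<lambda>x. f x mod 4 :: nat)"
  using tcomp_snd[OF tcomp_comp[OF tcomp_divmod_4]] by simp

lemma tcomp_step: "tcomp step"
  unfolding step_def eval_step_def ret_step_def Let_def
  by (intro comp_intros tcomp_div_4 tcomp_mod_4)

lemma tcomp_steps: "tcomp f \<Longrightarrow> tcomp g \<Longrightarrow> tcomp (\<lambda>x. (step ^^ f x) (g x))"
proof -
  have "(step ^^ n) s = rec_nat s (\<lambda>k. step) n" for n s by (induction n) auto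
  then show "tcomp f \<Longrightarrow> tcomp g \<Longrightarrow> ?thesis"
    by (simp only:) (intro tcomp_rec tcomp_comp[OF tcomp_step] tcomp_snd tcomp_id)
qed

lemma dcomp_computes_in:
  assumes "tcomp t" "tcomp e" "tcomp f" "tcomp g"
  shows "dcomp (\<lambda>x. computes_in (t x) (e x) (f x) (g x))"
  unfolding computes_in_def by (intro comp_intros tcomp_steps assms)

text \<open>The output and the number of steps that lead to it are searched for together.\<close>

lemma pcomp_phi:
  assumes "tcomp f" "tcomp g" shows "pcomp (\<lambda>x. phi (f x) (g x))"
proof -
  let ?D = "\<lambda>(ex :: nat \<times> nat) (yt :: nat \<times> nat). computes_in (snd yt) (fst ex) (snd ex) (fst yt)"
  let ?F = "\<lambda>ex. if \<exists>yt. ?D ex yt then Some (dec (LEAST n. ?D ex (dec n)) :: nat \<times> nat) else None"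
  have "pcomp ?F" by (intro pcomp_search dcomp_computes_in comp_intros)
  then have "pcomp (\<lambda>ex. Option.bind (?F ex) (\<lambda>yt. Some (fst yt)))"
    by (intro pcomp_bind pcomp_Some tcomp_fst tcomp_snd tcomp_id)
  moreover have "Option.bind (?F ex) (\<lambda>yt. Some (fst yt)) = phi (fst ex) (snd ex)" for ex
  proof (cases "\<exists>yt. ?D ex yt")
    case True
    then obtain yt where "?D ex yt" by blast
    then have "?D ex (dec (enc yt))" by (simp only: dec_enc)
    then have "?D ex (dec (LEAST n. ?D ex (dec n)))" by (rule LeastI[of "\<lambda>n. ?D ex (dec n)"])
    then have "phi (fst ex) (snd ex) = Some (fst (dec (LEAST n. ?D ex (dec n)) :: nat \<times> nat))"
      using phi_normal_form by blast
    then show ?thesis using True by simp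
  next
    case False
    then have "phi (fst ex) (snd ex) = None"
      using phi_normal_form[of "fst ex" "snd ex"] by (cases "phi (fst ex) (snd ex)") auto
    then show ?thesis using False by simp
  qed
  ultimately have "pcomp (\<lambda>ex. phi (fst ex) (snd ex))" by simp
  then show ?thesis by (rule pcomp_comp2) (rule assms)+
qed

section \<open>Computable operations on lists\<close>

lemma tcomp_foldl:
  assumes "tcomp f" "tcomp (\<lambda>z. G (fst z) (fst (snd z)) (snd (snd z)))" "tcomp h"
  shows "tcomp (\<lambda>x. foldl (G x) (f x) (h x))"
proof -
  have "pfold (\<lambda>s y. Some (G x s y)) (Some s) ys = Some (foldl (G x) s ys)" for x s ys
    by (induction ys arbitrary: s) simp_all
  then show ?thesis
    using pcomp_pfold[of "\<lambda>x. Some (f x)" "\<lambda>x s y. Some (G x s y)" h] assms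
    by (simp add: tcomp_def[of f] tcomp_def[of "\<lambda>x. foldl (G x) (f x) (h x)"]
        tcomp_def[of "\<lambda>z. G (fst z) (fst (snd z)) (snd (snd z))"])
qed

lemma tcomp_rev:
  fixes f :: "'a::numbered \<Rightarrow> 'b::numbered list"
  assumes "tcomp f" shows "tcomp (\<lambda>x. rev (f x))"
proof -
  have "foldl (\<lambda>acc y. y # acc) acc xs = rev xs @ acc" for acc xs :: "'b list"
    by (induction xs arbitrary: acc) simp_all
  then have "rev = (\<lambda>xs :: 'b list. foldl (\<lambda>acc y. y # acc) [] xs)" by (simp add: fun_eq_iff)
  moreover have "tcomp \<dots>" by (intro tcomp_foldl comp_intros)
  ultimately have "tcomp (rev :: 'b list \<Rightarrow> _)" by (simp only:)
  then show ?thesis using assms by (rule tcomp_comp)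
qed

lemma tcomp_snoc:
  assumes "tcomp f" "tcomp g" shows "tcomp (\<lambda>x. f x @ [g x])"
proof -
  have "ys @ [y] = rev (y # rev ys)" for y :: 'b and ys by simp
  then show ?thesis by (simp only:) (intro tcomp_rev comp_intros assms)
qed

lemma tcomp_length:
  fixes f :: "'a::numbered \<Rightarrow> 'b::numbered list"
  assumes "tcomp f" shows "tcomp (\<lambda>x. length (f x))"
proof -
  have "foldl (\<lambda>n y. Suc n) n xs = n + length xs" for n and xs :: "'b list"
    by (induction xs arbitrary: n) simp_all
  then have "length = (\<lambda>xs :: 'b list. foldl (\<lambda>n y. Suc n) 0 xs)" by (simp add: fun_eq_iff)
  moreover have "tcomp \<dots>" by (intro tcomp_foldl comp_intros)
  ultimately have "tcomp (length :: 'b list \<Rightarrow> _)" by (simp only:)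
  then show ?thesis using assms by (rule tcomp_comp)
qed

lemma tcomp_take:
  fixes g :: "'a::numbered \<Rightarrow> 'b::numbered list"
  assumes "tcomp f" "tcomp g" shows "tcomp (\<lambda>x. take (f x) (g x))"
proof -
  have "foldl (\<lambda>acc y. if length acc < n then acc @ [y] else acc) acc xs
      = acc @ take (n - length acc) xs" for n and acc xs :: "'b list"
  proof (induction xs arbitrary: acc)
    case (Cons x xs)
    then show ?case by (simp add: take_Cons')
  qed simp
  then have "take n xs = foldl (\<lambda>acc y. if length acc < n then acc @ [y] else acc) [] xs"
    for n and xs :: "'b list" by simp
  then show ?thesis
    by (simp only:) (intro tcomp_foldl tcomp_length tcomp_snoc comp_intros assms tcomp_comp[OF assms(1)])
qed

text \<open>The values of \<open>(!)\<close> beyond the end of a list are unspecified, so computability can only be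
  claimed for a function that agrees with it within the list.\<close>

lemma tcomp_nth:
  fixes g :: "'a::numbered \<Rightarrow> 'b::numbered list"
  assumes "tcomp f" "tcomp g"
  obtains h where "tcomp h" "\<And>x. f x < length (g x) \<Longrightarrow> h x = g x ! f x"
proof
  have drop: "rec_nat xs (\<lambda>k. tl) n = drop n xs" for n and xs :: "'b list"
    by (induction n) (simp_all add: drop_Suc tl_drop)
  show "tcomp (\<lambda>x. head (rec_nat (g x) (\<lambda>k. tl) (f x)))" by (intro comp_intros assms)
  show "head (rec_nat (g x) (\<lambda>k. tl) (f x)) = g x ! f x" if "f x < length (g x)" for x
    unfolding drop using that by (simp add: Cons_nth_drop_Suc[symmetric])
qed

section \<open>Parametrization and the recursion theorem\<close>

text \<open>A typed form of \<^const>\<open>phi\<close>, in which recursive programs with several arguments and with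
  lists as arguments can be specified by equations.\<close>

definition ev :: "nat \<Rightarrow> 'a::numbered \<Rightarrow> 'b::numbered option"
  where "ev e x = map_option dec (phi e (enc x))"

lemma ev_nat: "ev e x = phi e x"
  by (cases "phi e x") (simp_all add: ev_def)

lemma pcomp_ev:
  fixes f :: "'a::numbered \<Rightarrow> nat" and g :: "'a \<Rightarrow> 'b::numbered"
  assumes "tcomp f" "tcomp g" shows "pcomp (\<lambda>x. ev (f x) (g x) :: 'c::numbered option)"
proof -
  have "(ev e y :: 'c option) = Option.bind (phi e (enc y)) (\<lambda>r. Some (dec r))" for e and y :: 'b
    by (cases "phi e (enc y)") (simp_all add: ev_def)
  then show ?thesis by (simp only:) (intro pcomp_bind pcomp_phi comp_intros tcomp_enc tcomp_dec assms)
qed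

text \<open>The s-m-n theorem: a constant program supplies the first argument.\<close>

lemma parametrization:
  fixes F :: "'a::numbered \<Rightarrow> 'b::numbered \<Rightarrow> 'c::numbered option"
  assumes "pcomp (\<lambda>z. F (fst z) (snd z))"
  obtains S where "tcomp S" "\<And>a x. ev (S a) x = F a x"
proof -
  obtain p where p: "\<And>z. run p (enc z) = map_option enc (F (fst z) (snd z))"
    using assms unfolding pcomp_def by blast
  define S where "S a = index (Comp p (Pair (constant_prog (enc a)) identity_prog))" for a :: 'a
  have const: "index (constant_prog n) = rec_nat 0 (\<lambda>k r. 5 + 4 * prod_encode (1, r)) n" for n
    by (induction n) simp_all
  have "tcomp S"
    unfolding S_def index.simps const by (intro comp_intros tcomp_times tcomp_enc)
  moreover have "ev (S a) x = F a x" for a x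
    using p[of "(a, x)"]
    by (simp add: S_def ev_def phi_index enc_prod_def option.map_comp comp_def option.map_ident del: index.simps)
  ultimately show ?thesis by (rule that)
qed

text \<open>Let \<open>S d\<close> be an index for running \<open>d\<close> at pairs with first component \<open>d\<close>, and let \<open>d\<close> be an
  index of the map \<open>(d, x) \<mapsto> F (S d) x\<close>. Then \<open>S d\<close> is the required index.\<close>

lemma recursion_theorem:
  fixes F :: "nat \<Rightarrow> 'b::numbered \<Rightarrow> 'c::numbered option"
  assumes "pcomp (\<lambda>z. F (fst z) (snd z))"
  obtains e where "\<And>x. ev e x = F e x"
proof -
  have "pcomp (\<lambda>z. ev (fst z) (fst z, snd z) :: 'c option)" by (intro pcomp_ev comp_intros)
  then obtain S where S: "tcomp S" "\<And>d (x :: 'b). ev (S d) x = (ev d (d, x) :: 'c option)"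
    by (rule parametrization) (rule that)
  have "pcomp (\<lambda>z. F (S (fst (snd z))) (snd (snd z)))"
    by (rule pcomp_comp2[OF assms]) (intro comp_intros tcomp_comp[OF S(1)])+
  then have "pcomp (\<lambda>z :: nat \<times> nat \<times> 'b. case_prod (\<lambda>d. F (S d)) (snd z))"
    by (simp add: case_prod_unfold)
  then obtain D where D: "\<And>(n :: nat) z. ev (D n) z = case_prod (\<lambda>d. F (S d)) z"
    by (rule parametrization) (rule that)
  have "ev (S (D 0)) x = F (S (D 0)) x" for x
    by (simp add: S(2) D)
  then show ?thesis by (rule that)
qed

section \<open>Pairs and tuples in the first Kleene model\<close>

lemma app_Some [simp]: "Some a \<cdot>\<^bsub>A\<^esub> Some b = A a b"
  by (simp add: app_def)

lemma app_eq_Some: "x \<cdot>\<^bsub>A\<^esub> y = Some c \<longleftrightarrow> (\<exists>a b. x = Some a \<and> y = Some b \<and> A a b = Some c)"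
  by (auto simp: app_def bind_eq_Some_conv)

lemma K1_eq_phi [simp]: "K1 = phi"
  by (simp add: K1_def fun_eq_iff)

lemma is_pcaI:
  assumes "\<And>a. A k a = Some (k' a)" "\<And>a b. A (k' a) b = Some a"
    and "\<And>a. A s a = Some (s' a)" "\<And>a b. A (s' a) b = Some (s'' a b)"
    and "\<And>a b c x y v. A a c = Some x \<Longrightarrow> A b c = Some y \<Longrightarrow> A x y = Some v \<Longrightarrow> A (s'' a b) c = Some v"
  shows "is_pca A"
  unfolding is_pca_def
proof (intro exI allI conjI)
  fix a b c
  show "Some s \<cdot>\<^bsub>A\<^esub> Some a \<cdot>\<^bsub>A\<^esub> Some b \<noteq> None" by (simp add: assms(3,4))
  show "Some k \<cdot>\<^bsub>A\<^esub> Some a \<cdot>\<^bsub>A\<^esub> Some b = Some a" by (simp add: assms(1,2))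
  show "Some s \<cdot>\<^bsub>A\<^esub> Some a \<cdot>\<^bsub>A\<^esub> Some b \<cdot>\<^bsub>A\<^esub> Some c
      \<lesssim> Some a \<cdot>\<^bsub>A\<^esub> Some c \<cdot>\<^bsub>A\<^esub> (Some b \<cdot>\<^bsub>A\<^esub> Some c)"
    unfolding lesssim_def
  proof
    assume "Some a \<cdot>\<^bsub>A\<^esub> Some c \<cdot>\<^bsub>A\<^esub> (Some b \<cdot>\<^bsub>A\<^esub> Some c) \<noteq> None"
    then obtain v where v: "Some a \<cdot>\<^bsub>A\<^esub> Some c \<cdot>\<^bsub>A\<^esub> (Some b \<cdot>\<^bsub>A\<^esub> Some c) = Some v" by blast
    then obtain x y where "A a c = Some x" "A b c = Some y" "A x y = Some v"
      by (auto simp: app_eq_Some)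
    then have "A (s'' a b) c = Some v" by (rule assms(5))
    then show "Some s \<cdot>\<^bsub>A\<^esub> Some a \<cdot>\<^bsub>A\<^esub> Some b \<cdot>\<^bsub>A\<^esub> Some c \<noteq> None \<and>
      Some s \<cdot>\<^bsub>A\<^esub> Some a \<cdot>\<^bsub>A\<^esub> Some b \<cdot>\<^bsub>A\<^esub> Some c = Some a \<cdot>\<^bsub>A\<^esub> Some c \<cdot>\<^bsub>A\<^esub> (Some b \<cdot>\<^bsub>A\<^esub> Some c)"
      using v by (simp add: assms(3,4))
  qed
qed

lemma the_unique_eq_Some:
  assumes "\<And>c c'. P c \<Longrightarrow> P c' \<Longrightarrow> c = c'"
  shows "the_unique P = Some m \<longleftrightarrow> P m"
proof
  assume "P m"
  moreover from this have "(THE c. P c) = m" using assms by (intro the_equality) simp_all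
  ultimately show "the_unique P = Some m" unfolding the_unique_def using assms by metis
next
  assume "the_unique P = Some m"
  then have "\<exists>!c. P c" "m = (THE c. P c)" unfolding the_unique_def by (metis option.distinct(1), metis option.inject option.distinct(1))
  then show "P m" using theI' by simp
qed

text \<open>The combinators enter through two facts: pairing and the coding of tuples are total
  computable injections, whose inverses are found by search, and the two booleans differ.\<close>

locale K1_combinators =
  fixes C :: "nat combinators"
  assumes valid: "valid_combinators K1 C"
begin

lemma valid_booleans:
  "\<forall>a b. Some (truth C) \<cdot>\<^bsub>K1\<^esub> Some a \<cdot>\<^bsub>K1\<^esub> Some b = Some a"
  "\<forall>a b. Some (falsity C) \<cdot>\<^bsub>K1\<^esub> Some a \<cdot>\<^bsub>K1\<^esub> Some b = Some b"
proof -
  note v = valid[unfolded valid_combinators_def]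
  from v show "\<forall>a b. Some (truth C) \<cdot>\<^bsub>K1\<^esub> Some a \<cdot>\<^bsub>K1\<^esub> Some b = Some a" by (elim conjE)
  from v show "\<forall>a b. Some (falsity C) \<cdot>\<^bsub>K1\<^esub> Some a \<cdot>\<^bsub>K1\<^esub> Some b = Some b" by (elim conjE)
qed

lemma valid_pairing:
  "\<exists>p0 p1. \<forall>a b.
     Some p0 \<cdot>\<^bsub>K1\<^esub> (Some (pairing C) \<cdot>\<^bsub>K1\<^esub> Some a \<cdot>\<^bsub>K1\<^esub> Some b) = Some a \<and>
     Some p1 \<cdot>\<^bsub>K1\<^esub> (Some (pairing C) \<cdot>\<^bsub>K1\<^esub> Some a \<cdot>\<^bsub>K1\<^esub> Some b) = Some b"
  using valid unfolding valid_combinators_def by (elim conjE)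

lemma valid_tuple:
  "\<exists>num sg len prj cat. numeral_system K1 (truth C) (falsity C) num \<and>
     (\<forall>a. Some sg \<cdot>\<^bsub>K1\<^esub> Some a = Some (tuple C [a])) \<and>
     (\<forall>u. Some len \<cdot>\<^bsub>K1\<^esub> Some (tuple C u) = Some (num (length u))) \<and>
     (\<forall>u. \<forall>i < length u. Some prj \<cdot>\<^bsub>K1\<^esub> Some (num i) \<cdot>\<^bsub>K1\<^esub> Some (tuple C u) = Some (u ! i)) \<and>
     (\<forall>u v. Some cat \<cdot>\<^bsub>K1\<^esub> Some (tuple C u) \<cdot>\<^bsub>K1\<^esub> Some (tuple C v) = Some (tuple C (u @ v)))"
  using valid unfolding valid_combinators_def by (elim conjE)

definition pr :: "nat \<Rightarrow> nat \<Rightarrow> nat"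
  where "pr a b = the (Some (pairing C) \<cdot>\<^bsub>K1\<^esub> Some a \<cdot>\<^bsub>K1\<^esub> Some b)"

lemma pairing_total: "\<exists>q. phi (pairing C) a = Some q \<and> phi q b = Some (pr a b)"
proof -
  obtain p0 where "Some p0 \<cdot>\<^bsub>K1\<^esub> (Some (pairing C) \<cdot>\<^bsub>K1\<^esub> Some a \<cdot>\<^bsub>K1\<^esub> Some b) = Some a"
    using valid_pairing by metis
  then obtain z where z: "Some (pairing C) \<cdot>\<^bsub>K1\<^esub> Some a \<cdot>\<^bsub>K1\<^esub> Some b = Some z"
    unfolding app_eq_Some[of "Some p0"] by blast
  then have "pr a b = z" by (simp add: pr_def)
  then show ?thesis using z unfolding app_eq_Some by auto
qed

lemma pairing_eq: "Some (pairing C) \<cdot>\<^bsub>K1\<^esub> Some a \<cdot>\<^bsub>K1\<^esub> Some b = Some (pr a b)"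
  using pairing_total[of a b] by (auto simp: app_eq_Some)

lemma pr_inject [simp]: "pr a b = pr a' b' \<longleftrightarrow> a = a' \<and> b = b'"
proof -
  obtain p0 p1 where p: "\<forall>a b.
     Some p0 \<cdot>\<^bsub>K1\<^esub> (Some (pairing C) \<cdot>\<^bsub>K1\<^esub> Some a \<cdot>\<^bsub>K1\<^esub> Some b) = Some a \<and>
     Some p1 \<cdot>\<^bsub>K1\<^esub> (Some (pairing C) \<cdot>\<^bsub>K1\<^esub> Some a \<cdot>\<^bsub>K1\<^esub> Some b) = Some b"
    using valid_pairing by (elim exE)
  have p: "phi p0 (pr a b) = Some a" "phi p1 (pr a b) = Some b" for a b
    using p unfolding pairing_eq by simp_all
  show ?thesis using p[of a b] p[of a' b'] by auto
qed

lemma tcomp_pr: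
  assumes "tcomp f" "tcomp g" shows "tcomp (\<lambda>x. pr (f x) (g x))"
proof -
  have "Some (pr a b) = Option.bind (phi (pairing C) a) (\<lambda>q. phi q b)" for a b
    using pairing_total[of a b] by auto
  then show ?thesis unfolding tcomp_def
    by (simp only:) (intro pcomp_bind pcomp_phi comp_intros assms tcomp_comp[OF assms(2)])
qed

definition unpair :: "nat \<Rightarrow> (nat \<times> nat) option"
  where "unpair x = (if \<exists>z. pr (fst z) (snd z) = x then Some (THE z. pr (fst z) (snd z) = x) else None)"

lemma unpair_pr [simp]: "unpair (pr a b) = Some (a, b)"
proof -
  have "(THE z. pr (fst z) (snd z) = pr a b) = (a, b)" by (rule the_equality) auto
  moreover have "\<exists>z. pr (fst z) (snd z) = pr a b" by (rule exI[of _ "(a, b)"]) simp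
  ultimately show ?thesis by (simp only: unpair_def if_True)
qed

lemma unpair_eq_Some: "unpair x = Some (a, b) \<longleftrightarrow> x = pr a b"
proof
  assume "unpair x = Some (a, b)"
  then have "\<exists>z. pr (fst z) (snd z) = x" unfolding unpair_def by (metis option.distinct(1))
  then obtain a' b' where "x = pr a' b'" by auto
  then show "x = pr a b" using \<open>unpair x = Some (a, b)\<close> by simp
qed simp

lemma pcomp_unpair: "tcomp f \<Longrightarrow> pcomp (\<lambda>x. unpair (f x))"
proof (rule pcomp_comp[of unpair])
  show "pcomp unpair"
    unfolding unpair_def by (intro pcomp_the tcomp_pr comp_intros) (auto simp: prod_eq_iff)
qed

abbreviation tup :: "nat list \<Rightarrow> nat" where "tup \<equiv> tuple C"

lemma truth_neq_falsity: "truth C \<noteq> falsity C"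
proof
  assume eq: "truth C = falsity C"
  show False using valid_booleans[THEN spec, THEN spec, of 0 1] by (simp add: eq)
qed

text \<open>A numeral system is injective because it has a zero test and a predecessor, so the length
  and then the entries of a tuple are determined by its code.\<close>

lemma tup_inject: "tup u = tup v \<longleftrightarrow> u = v"
proof
  assume eq: "tup u = tup v"
  obtain num len prj where num: "numeral_system K1 (truth C) (falsity C) num"
    and len: "\<And>u. Some len \<cdot>\<^bsub>K1\<^esub> Some (tup u) = Some (num (length u))"
    and prj: "\<And>u i. i < length u \<Longrightarrow>
      Some prj \<cdot>\<^bsub>K1\<^esub> Some (num i) \<cdot>\<^bsub>K1\<^esub> Some (tup u) = Some (u ! i)"
    using valid_tuple by metis
  obtain pd zt where
    pd: "\<And>n. phi pd (num (Suc n)) = Some (num n)" and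
    zt: "phi zt (num 0) = Some (truth C)" "\<And>n. phi zt (num (Suc n)) = Some (falsity C)"
    using num unfolding numeral_system_def by auto
  have zero: "num 0 \<noteq> num (Suc n)" for n
    using zt(1) zt(2)[of n] truth_neq_falsity by auto
  have num_inj: "num m = num n \<Longrightarrow> m = n" for m n
  proof (induction m arbitrary: n)
    case 0
    then show ?case using zero by (cases n) auto
  next
    case (Suc m)
    then obtain k where k: "n = Suc k" using zero by (cases n) (auto dest: sym)
    then have "num m = num k" using pd[of m] pd[of k] Suc.prems by simp
    then show ?case using Suc.IH k by simp
  qed
  have "num (length u) = num (length v)" using len[of u] len[of v] eq by simp
  then have l: "length u = length v" by (rule num_inj)
  show "u = v"
  proof (rule nth_equalityI[OF l])
    fix i assume "i < length u"
    then show "u ! i = v ! i" using prj[of i u] prj[of i v] l eq by simp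
  qed
qed simp

lemma tcomp_tup:
  assumes "tcomp f" shows "tcomp (\<lambda>x. tup (f x))"
proof -
  obtain sg cat where sg: "\<And>a. Some sg \<cdot>\<^bsub>K1\<^esub> Some a = Some (tup [a])"
    and cat: "\<And>u v. Some cat \<cdot>\<^bsub>K1\<^esub> Some (tup u) \<cdot>\<^bsub>K1\<^esub> Some (tup v) = Some (tup (u @ v))"
    using valid_tuple by metis
  let ?G = "\<lambda>acc y. Option.bind (phi cat acc) (\<lambda>q. Option.bind (phi sg y) (\<lambda>r. phi q r))"
  have G: "?G (tup u) y = Some (tup (u @ [y]))" for u y
    using sg[of y] cat[of u "[y]"] by (auto simp: app_eq_Some)
  have "pfold ?G (Some (tup u)) ys = Some (tup (u @ ys))" for u ys
    by (induction ys arbitrary: u) (simp_all add: G)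
  from this[of "[]"] have "(\<lambda>xs. Some (tup xs)) = (\<lambda>xs. pfold ?G (Some (tup [])) xs)" by simp
  moreover have "pcomp (\<lambda>xs. pfold ?G (Some (tup [])) xs)" by (intro pcomp_pfold pcomp_phi comp_intros)
  ultimately have "tcomp tup" unfolding tcomp_def by (simp only:)
  then show ?thesis using assms by (rule tcomp_comp)
qed

definition untup :: "nat \<Rightarrow> nat list option"
  where "untup x = (if \<exists>u. tup u = x then Some (THE u. tup u = x) else None)"

lemma untup_tup [simp]: "untup (tup u) = Some u"
  by (auto simp: untup_def tup_inject)

lemma pcomp_untup: "tcomp f \<Longrightarrow> pcomp (\<lambda>x. untup (f x))"
proof (rule pcomp_comp[of untup])
  show "pcomp untup"
    unfolding untup_def by (intro pcomp_the tcomp_tup comp_intros) (auto simp: tup_inject)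
qed

section \<open>Pitts' operator as an inductive predicate\<close>

text \<open>The least set in the definition of \<^const>\<open>pitts_J\<close>, with its induction principle. The
  bound \<open>n\<close> of a node is not part of the code of the node.\<close>

inductive J :: "nat set \<Rightarrow> nat \<Rightarrow> bool" for P
  where
    leaf: "m \<in> P \<Longrightarrow> J P (pr 0 m)"
  | node: "(\<And>k. n \<le> k \<Longrightarrow> \<exists>y. phi a k = Some y \<and> J P y) \<Longrightarrow> J P (pr (Suc 0) a)"

lemma mem_pitts_J: "x \<in> pitts_J C P \<longleftrightarrow> J P x"
proof
  have node': "conj_set C {1} (\<Union>n. imp_set {m. m \<ge> n} Q)
      = {pr (Suc 0) a | a. \<exists>n. \<forall>k \<ge> n. \<exists>y \<in> Q. phi a k = Some y}" for Q
    unfolding conj_set_def imp_set_def pairing_eq by auto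
  have leaf': "conj_set C {0} P = pr 0 ` P"
    unfolding conj_set_def pairing_eq by auto
  assume "x \<in> pitts_J C P"
  moreover have "conj_set C {1} (\<Union>n. imp_set {m. m \<ge> n} (Collect (J P))) \<subseteq> Collect (J P)"
    unfolding node'
  proof clarify
    fix a n assume "\<forall>k \<ge> n. \<exists>y \<in> Collect (J P). phi a k = Some y"
    then show "J P (pr (Suc 0) a)" by (intro node[of n]) auto
  qed
  moreover have "conj_set C {0} P \<subseteq> Collect (J P)" unfolding leaf' by (auto intro: leaf)
  ultimately show "J P x" unfolding pitts_J_def by blast
next
  assume "J P x"
  then show "x \<in> pitts_J C P"
  proof (induction)
    case (leaf m)
    then show ?case unfolding pitts_J_def conj_set_def pairing_eq by auto
  next
    case (node n a)
    show ?case unfolding pitts_J_def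
    proof (rule InterI, clarify)
      fix Q assume Q: "conj_set C {0} P \<subseteq> Q" "conj_set C {1} (\<Union>n. imp_set {m. m \<ge> n} Q) \<subseteq> Q"
      have "a \<in> imp_set {m. m \<ge> n} Q"
        using node Q unfolding imp_set_def pitts_J_def by fastforce
      then show "pr (Suc 0) a \<in> Q" using Q(2) unfolding conj_set_def pairing_eq by auto
    qed
  qed
qed

lemma J_leaf_iff [simp]: "J P (pr 0 m) \<longleftrightarrow> m \<in> P"
  by (auto intro: leaf elim: J.cases)

lemma J_node_iff: "J P (pr (Suc 0) a) \<longleftrightarrow> (\<exists>n. \<forall>k \<ge> n. \<exists>y. phi a k = Some y \<and> J P y)"
proof
  assume "J P (pr (Suc 0) a)"
  then show "\<exists>n. \<forall>k \<ge> n. \<exists>y. phi a k = Some y \<and> J P y"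
    by (cases rule: J.cases) auto
qed (auto intro: node)

text \<open>A child beyond the larger of two bounds belongs to both sets.\<close>

lemma J_meet: "J P x \<Longrightarrow> J Q x \<Longrightarrow> P \<inter> Q \<noteq> {}"
proof (induction rule: J.induct)
  case (node n a)
  from node.prems obtain n' where n': "\<forall>k \<ge> n'. \<exists>y. phi a k = Some y \<and> J Q y"
    by (auto simp: J_node_iff)
  obtain y where "phi a (max n n') = Some y" "J Q y" using n'[rule_format, of "max n n'"] by auto
  moreover obtain y' where "phi a (max n n') = Some y'" "J Q y' \<longrightarrow> P \<inter> Q \<noteq> {}"
    using node.IH[of "max n n'"] by auto
  ultimately show ?case by simp
qed auto

lemma J_mono: "J P x \<Longrightarrow> P \<subseteq> Q \<Longrightarrow> J Q x"
proof (induction rule: J.induct)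
  case (node n a)
  have "\<exists>y. phi a k = Some y \<and> J Q y" if "n \<le> k" for k using node.IH[OF that] node.prems by blast
  then show ?case by (rule J.node)
qed (auto intro: leaf)

definition yields :: "nat set \<Rightarrow> nat option \<Rightarrow> bool"
  where "yields P r \<longleftrightarrow> (\<exists>y. r = Some y \<and> J P y)"

lemma yields_simps [simp]: "yields P (Some y) \<longleftrightarrow> J P y" "\<not> yields P None"
  by (simp_all add: yields_def)

lemma yields_unique: "yields {m} r \<Longrightarrow> yields {m'} r \<Longrightarrow> m = m'"
  using J_meet[of "{m}" _ "{m'}"] by (auto simp: yields_def)

lemma J1_eq_Some: "J1 C e n = Some m \<longleftrightarrow> yields {m} (phi e n)"
proof -
  have "(\<lambda>m. \<exists>x. phi e n = Some x \<and> x \<in> pitts_J C {m}) = (\<lambda>m. yields {m} (phi e n))"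
    by (simp add: yields_def mem_pitts_J)
  then have "J1 C e n = the_unique (\<lambda>m. yields {m} (phi e n))" by (simp only: J1_def)
  then show ?thesis
    using the_unique_eq_Some[of "\<lambda>m. yields {m} (phi e n)"] yields_unique by simp
qed

text \<open>\<open>B x h\<close> grafts the computation with index \<open>h\<close> onto the leaves of the tree \<open>x\<close>.\<close>

definition binds :: "(nat \<Rightarrow> nat \<Rightarrow> nat option) \<Rightarrow> bool"
  where "binds B \<longleftrightarrow> pcomp (\<lambda>z. B (fst z) (snd z)) \<and>
     (\<forall>P Q r h. yields P r \<longrightarrow> (\<forall>m \<in> P. yields Q (phi h m)) \<longrightarrow> yields Q (Option.bind r (\<lambda>x. B x h)))"

text \<open>Grafting is recursive in the tree, hence given by the recursion theorem. At a node it does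
  not enter the children but returns an index for grafting onto them, so it is defined although
  some children may be undefined.\<close>

lemma ex_binds: "\<exists>B. binds B"
proof -
  define H :: "nat \<times> nat \<times> nat \<Rightarrow> nat \<Rightarrow> nat option"
    where "H p k = Option.bind (phi (fst (snd p)) k) (\<lambda>y. ev (fst p) (y, snd (snd p)))" for p k
  have "pcomp (\<lambda>z. H (fst z) (snd z))"
    unfolding H_def by (intro pcomp_phi pcomp_ev comp_intros)
  then obtain S where S: "tcomp S" "\<And>p k. ev (S p) k = H p k"
    by (rule parametrization) (rule that)
  define F where "F e z = Option.bind (unpair (fst z)) (\<lambda>tc.
      if fst tc = 0 then phi (snd z) (snd tc) else Some (pr (Suc 0) (S (e, snd tc, snd z))))" for e z
  have "pcomp (\<lambda>z. F (fst z) (snd z))"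
    unfolding F_def by (intro pcomp_unpair tcomp_pr pcomp_phi tcomp_comp[OF S(1)] comp_intros)
  then obtain e where e: "\<And>z. (ev e z :: nat option) = F e z" by (rule recursion_theorem) (rule that)
  define B :: "nat \<Rightarrow> nat \<Rightarrow> nat option" where "B x h = ev e (x, h)" for x h
  have B: "B (pr 0 m) h = phi h m" "B (pr (Suc 0) a) h = Some (pr (Suc 0) (S (e, a, h)))"
     "phi (S (e, a, h)) k = Option.bind (phi a k) (\<lambda>y. B y h)" for m a h k
    by (simp_all add: B_def e F_def S(2)[unfolded ev_nat] H_def)
  have "yields Q (B x h)" if "J P x" "\<forall>m \<in> P. yields Q (phi h m)" for P Q x h
    using that
  proof (induction)
    case (node n a)
    have "\<exists>y. phi (S (e, a, h)) k = Some y \<and> J Q y" if k: "n \<le> k" for k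
    proof -
      obtain y where "phi a k = Some y" "yields Q (B y h)" using node k by blast
      then show ?thesis by (auto simp: B yields_def)
    qed
    then have "J Q (pr (Suc 0) (S (e, a, h)))" by (rule J.node)
    then show ?case by (simp only: B yields_simps)
  qed (simp add: B)
  then have "\<forall>P Q r h. yields P r \<longrightarrow> (\<forall>m \<in> P. yields Q (phi h m)) \<longrightarrow> yields Q (Option.bind r (\<lambda>x. B x h))"
    by (auto simp only: yields_def[of _ r for r] Option.bind.simps)
  moreover have "pcomp (\<lambda>z. B (fst z) (snd z))"
    unfolding B_def by (intro pcomp_ev comp_intros)
  ultimately have "binds B" unfolding binds_def by blast
  then show ?thesis by blast
qed

section \<open>Dialogues evaluated by trees\<close>

definition E_graph :: "(nat \<times> nat) set"
  where "E_graph = functional_oracle K1 C (\<lambda>g. Some (functional_E g))"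

lemma dialogue_iff:
  "dialogue K1 C f a b u \<longleftrightarrow>
     (\<forall>i < length u. \<exists>v. phi a (tup (b # take i u)) = Some (pr (falsity C) v) \<and> (v, u ! i) \<in> f)"
  unfolding dialogue_def pairing_eq by simp

lemma oracle_result_iff:
  "oracle_result K1 C f a b c \<longleftrightarrow>
     (\<exists>u. dialogue K1 C f a b u \<and> phi a (tup (b # u)) = Some (pr (truth C) c))"
  unfolding oracle_result_def pairing_eq by simp

lemma E_graph_I:
  assumes "\<And>x. oracle_result K1 C E_graph v x (g x)"
  shows "(v, functional_E g) \<in> E_graph"
  using assms functional_oracle_fixpoint[of K1 C "\<lambda>g. Some (functional_E g)"]
  unfolding E_graph_def functional_step_def by blast

lemma E_graph_least:
  assumes "\<And>v g. (\<And>x. oracle_result K1 C X v x (g x)) \<Longrightarrow> (v, functional_E g) \<in> X"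
  shows "E_graph \<subseteq> X"
proof -
  have "functional_step K1 C (\<lambda>g. Some (functional_E g)) X \<subseteq> X"
    using assms unfolding functional_step_def by auto
  then show ?thesis
    unfolding E_graph_def functional_oracle_def
    using iteration_stage_least[OF Well_order_stage_order mono_functional_step] by blast
qed

lemma bind_step:
  assumes "binds B" "yields P r" "\<And>m. m \<in> P \<Longrightarrow> yields Q (phi h m)"
  shows "yields Q (Option.bind r (\<lambda>x. B x h))"
  using assms unfolding binds_def by simp

lemma pcomp_binds:
  assumes "binds B" "tcomp f" "tcomp g"
  shows "pcomp (\<lambda>x. B (f x) (g x))"
proof -
  from assms(1) have "pcomp (\<lambda>z. B (fst z) (snd z))" by (simp add: binds_def)
  then show ?thesis using assms(2,3) by (rule pcomp_comp2)
qed

definition zero_test :: "(nat \<Rightarrow> nat) \<Rightarrow> nat \<Rightarrow> nat"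
  where "zero_test g k = (if \<exists>x < k. g x = 0 then 0 else 1)"

text \<open>\<open>L e v k\<close> sequences trees for \<open>g 0, \<dots>, g (k - 1)\<close>. All of them have results, since \<open>g\<close> is
  total.\<close>

lemma ex_zero_test:
  "\<exists>L. pcomp (\<lambda>z. L (fst z) (fst (snd z)) (snd (snd z))) \<and>
     (\<forall>e v g k. (\<forall>x. yields {g x} (ev e (v :: nat, [x :: nat]))) \<longrightarrow> yields {zero_test g k} (L e v k))"
proof -
  obtain B where B: "binds B" using ex_binds by blast
  define H :: "nat \<Rightarrow> nat \<Rightarrow> nat option"
    where "H y w = (if w = 0 then Some (pr 0 0) else Some y)" for y w
  have "pcomp (\<lambda>z. H (fst z) (snd z))"
    unfolding H_def by (intro comp_intros)
  then obtain S where S: "tcomp S" "\<And>y w. ev (S y) w = H y w"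
    by (rule parametrization) (rule that)
  \<comment> \<open>If \<open>g k\<close> is 0, the result is replaced by 0; otherwise the tree \<open>y\<close> for the smaller arguments
      is kept.\<close>
  define L :: "nat \<Rightarrow> nat \<Rightarrow> nat \<Rightarrow> nat option"
    where "L e v k = rec_nat (Some (pr 0 1))
      (\<lambda>k r. Option.bind r (\<lambda>y. Option.bind (ev e (v, [k])) (\<lambda>x. B x (S y)))) k" for e v k
  have "pcomp (\<lambda>z. L (fst z) (fst (snd z)) (snd (snd z)))"
    unfolding L_def
    by (intro pcomp_rec pcomp_bind pcomp_ev pcomp_binds[OF B] tcomp_comp[OF S(1)] comp_intros)
  moreover have "yields {zero_test g k} (L e v k)"
    if g: "\<And>x. yields {g x} (ev e (v, [x]))" for e v g k
  proof (induction k)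
    case 0
    show ?case by (simp add: L_def zero_test_def)
  next
    case (Suc k)
    then obtain y where y: "L e v k = Some y" "J {zero_test g k} y" by (auto simp: yields_def)
    have "yields {zero_test g (Suc k)} (phi (S y) (g k))"
      using y(2) by (auto simp: S(2)[unfolded ev_nat] H_def zero_test_def less_Suc_eq split: if_splits)
    then have "yields {zero_test g (Suc k)} (Option.bind (ev e (v, [k])) (\<lambda>x. B x (S y)))"
      by (intro bind_step[OF B g]) simp
    then show ?case using y(1) by (simp add: L_def)
  qed
  ultimately show ?thesis by blast
qed

text \<open>The evaluator with index \<open>e\<close> maps \<open>(a, t)\<close> to a tree for the result of the dialogue in which
  \<open>t\<close> is the input of \<open>a\<close> followed by the replies so far. It answers the query \<open>v\<close> by a node whose
  \<open>k\<close>-th child looks for a zero below \<open>k\<close> of the function computed by \<open>v\<close>. These children are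
  eventually constant, with \<^const>\<open>functional_E\<close> of that function as their result. Hence the
  correctly answered queries \<open>X\<close> are closed under the generation of \<^const>\<open>E_graph\<close>.\<close>

lemma ex_J_evaluation:
  "\<exists>M. pcomp (\<lambda>z. M (fst z) (snd z)) \<and>
     (\<forall>a b c. oracle_result K1 C E_graph a b c \<longrightarrow> yields {c} (M a b))"
proof -
  obtain B where B: "binds B" using ex_binds by blast
  obtain L where L: "pcomp (\<lambda>z. L (fst z) (fst (snd z)) (snd (snd z)))"
    "\<forall>e v g k. (\<forall>x. yields {g x} (ev e (v :: nat, [x :: nat]))) \<longrightarrow> yields {zero_test g k} (L e v k)"
    using ex_zero_test by blast
  have "pcomp (\<lambda>z. (\<lambda>p. L (fst p) (snd p)) (fst z) (snd z))"
    by (intro pcomp_comp3[OF L(1)] comp_intros)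
  then obtain S1 where S1: "tcomp S1" "\<And>p k. ev (S1 p) k = L (fst p) (snd p) k"
    by (rule parametrization) (rule that)
  define H :: "nat \<times> nat \<times> nat list \<Rightarrow> nat \<Rightarrow> nat option"
    where "H p w = ev (fst p) (fst (snd p), snd (snd p) @ [w])" for p w
  have "pcomp (\<lambda>z. H (fst z) (snd z))"
    unfolding H_def by (intro pcomp_ev tcomp_snoc comp_intros)
  then obtain S2 where S2: "tcomp S2" "\<And>p w. ev (S2 p) w = H p w"
    by (rule parametrization) (rule that)
  define F :: "nat \<Rightarrow> nat \<times> nat list \<Rightarrow> nat option"
    where "F e z = Option.bind (phi (fst z) (tup (snd z))) (\<lambda>y. Option.bind (unpair y) (\<lambda>bc.
      if fst bc = truth C then Some (pr 0 (snd bc))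
      else B (pr (Suc 0) (S1 (e, snd bc))) (S2 (e, z))))" for e z
  have "pcomp (\<lambda>z. F (fst z) (snd z))"
    unfolding F_def
    by (intro pcomp_phi pcomp_unpair pcomp_binds[OF B] tcomp_pr tcomp_tup tcomp_comp[OF S1(1)]
        tcomp_comp[OF S2(1)] comp_intros)
  then obtain e where e: "\<And>z. ev e z = F e z" by (rule recursion_theorem) (rule that)
  define X where "X = {(v, w). J {w} (pr (Suc 0) (S1 (e, v)))}"
  have final: "ev e (a, t) = Some (pr 0 c)" if "phi a (tup t) = Some (pr (truth C) c)" for a t c
    using that by (simp add: e F_def)
  have query: "yields {c} (ev e (a, t))"
    if "phi a (tup t) = Some (pr (falsity C) v)" "(v, w) \<in> X" "yields {c} (ev e (a, t @ [w]))"
    for a t v w c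
  proof -
    have "yields {c} (Option.bind (Some (pr (Suc 0) (S1 (e, v)))) (\<lambda>x. B x (S2 (e, a, t))))"
      using that(2,3) by (intro bind_step[OF B, of "{w}"]) (auto simp: X_def S2(2)[unfolded ev_nat] H_def)
    then show ?thesis using that(1) truth_neq_falsity by (simp add: e F_def)
  qed
  have result: "yields {c} (ev e (a, [b]))" if res: "oracle_result K1 C X a b c" for a b c
  proof -
    obtain u where u: "dialogue K1 C X a b u" "phi a (tup (b # u)) = Some (pr (truth C) c)"
      using res unfolding oracle_result_iff by blast
    have "yields {c} (ev e (a, b # take (length u - d) u))" if "d \<le> length u" for d
      using that
    proof (induction d)
      case 0
      then show ?case using final[OF u(2)] by simp
    next
      case (Suc d)
      let ?i = "length u - Suc d"
      have i: "?i < length u" "Suc ?i = length u - d" using Suc.prems by auto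
      obtain v where v: "phi a (tup (b # take ?i u)) = Some (pr (falsity C) v)" "(v, u ! ?i) \<in> X"
        using u(1) i(1) unfolding dialogue_iff by blast
      have "take (length u - d) u = take ?i u @ [u ! ?i]"
        using i by (metis take_Suc_conv_app_nth)
      then show ?case using Suc query[OF v] by simp
    qed
    from this[of "length u"] show ?thesis by simp
  qed
  have "E_graph \<subseteq> X"
  proof (rule E_graph_least)
    fix v g assume "\<And>x. oracle_result K1 C X v x (g x)"
    then have L': "yields {zero_test g k} (phi (S1 (e, v)) k)" for k
      using L(2) result by (simp add: S1(2)[unfolded ev_nat])
    obtain n where "\<And>k. n \<le> k \<Longrightarrow> zero_test g k = functional_E g"
    proof (cases "\<exists>x. g x = 0")
      case True
      then obtain x where x: "g x = 0" by blast
      have "zero_test g k = functional_E g" if "Suc x \<le> k" for k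
        using x that unfolding zero_test_def functional_E_def by (auto simp: Suc_le_eq)
      then show ?thesis by (rule that)
    next
      case False
      then have "zero_test g k = functional_E g" for k
        unfolding zero_test_def functional_E_def by auto
      then show ?thesis using that by blast
    qed
    then have "J {functional_E g} (pr (Suc 0) (S1 (e, v)))"
      using L' unfolding J_node_iff yields_def by metis
    then show "(v, functional_E g) \<in> X" by (simp add: X_def)
  qed
  then have "oracle_result K1 C E_graph a b c \<Longrightarrow> oracle_result K1 C X a b c" for a b c
    unfolding oracle_result_iff dialogue_iff by blast
  then have "\<forall>a b c. oracle_result K1 C E_graph a b c \<longrightarrow> yields {c} (ev e (a, [b]))"
    using result by blast
  moreover have "pcomp (\<lambda>z. ev e (fst z, [snd z]) :: nat option)"
    by (intro pcomp_ev comp_intros)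
  ultimately show ?thesis by (intro exI[of _ "\<lambda>a b. ev e (a, [b])"]) simp
qed

text \<open>Two results of the same dialogue would be results of the same tree.\<close>

lemma K1_E_eq_Some: "K1_E C a b = Some c \<longleftrightarrow> oracle_result K1 C E_graph a b c"
proof -
  obtain M where "\<And>a b c. oracle_result K1 C E_graph a b c \<Longrightarrow> yields {c} (M a b)"
    using ex_J_evaluation by blast
  then have "oracle_result K1 C E_graph a b c \<Longrightarrow> oracle_result K1 C E_graph a b c' \<Longrightarrow> c = c'" for c c'
    using yields_unique by blast
  then show ?thesis
    unfolding K1_E_def functional_pas_def oracle_pas_def E_graph_def[symmetric]
    by (rule the_unique_eq_Some)
qed

end

section \<open>Bars of finite sequences\<close>

definition seg :: "(nat \<Rightarrow> nat) \<Rightarrow> nat \<Rightarrow> nat list"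
  where "seg \<sigma> n = map \<sigma> [0..<n]"

lemma seg_simps [simp]: "seg \<sigma> 0 = []" "length (seg \<sigma> n) = n"
  by (simp_all add: seg_def)

lemma seg_Suc: "seg \<sigma> (Suc n) = seg \<sigma> n @ [\<sigma> n]"
  by (simp add: seg_def)

lemma nth_seg [simp]: "i < n \<Longrightarrow> seg \<sigma> n ! i = \<sigma> i"
  by (simp add: seg_def)

lemma take_seg: "l \<le> n \<Longrightarrow> take l (seg \<sigma> n) = seg \<sigma> l"
  by (simp add: seg_def take_map)

text \<open>Otherwise, the empty sequence could be extended again and again without acquiring the
  property \<open>P\<close>, to an infinite sequence that never meets the bar.\<close>

lemma bar_induction:
  assumes bar: "\<And>\<sigma>. \<exists>n. D (seg \<sigma> n)"
    and base: "\<And>s. D s \<Longrightarrow> P s"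
    and step: "\<And>s. (\<And>i. P (s @ [i])) \<Longrightarrow> P s"
  shows "P []"
proof (rule ccontr)
  assume "\<not> P []"
  define next_entry where "next_entry s = (SOME i. \<not> P (s @ [i]))" for s
  define S where "S = rec_nat [] (\<lambda>_ s. s @ [next_entry s])"
  have ne: "\<not> P (s @ [next_entry s])" if "\<not> P s" for s
    unfolding next_entry_def using step[of s] that by (intro someI_ex[of "\<lambda>i. \<not> P (s @ [i])"]) blast
  have S: "S 0 = []" "S (Suc n) = S n @ [next_entry (S n)]" for n
    by (simp_all add: S_def)
  have "\<not> P (S n) \<and> seg (\<lambda>n. next_entry (S n)) n = S n" for n
    by (induction n) (auto simp: S seg_Suc ne \<open>\<not> P []\<close>)
  moreover obtain n where "D (seg (\<lambda>n. next_entry (S n)) n)" using bar by blast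
  ultimately show False using base by metis
qed

text \<open>A semidecidable bar has a decidable counterpart, which is met later. A witness \<open>(l, w, t)\<close>
  for acceptance of the segment of length \<open>l\<close> after \<open>t\<close> machine steps is tested when the length of
  the sequence codes this witness. A code is at least as large as its components, so the segment
  is available by then.\<close>

lemma decidable_bar:
  fixes G :: "'a::numbered \<Rightarrow> nat list \<Rightarrow> 'b::numbered \<Rightarrow> nat option"
  assumes "pcomp (\<lambda>z. G (fst z) (fst (snd z)) (snd (snd z)))"
  shows "\<exists>D. dcomp (\<lambda>z. D (fst z) (snd z)) \<and> (\<forall>z. \<not> D z []) \<and>
    (\<forall>z \<sigma>. (\<exists>n. D z (seg \<sigma> n)) \<longleftrightarrow> (\<exists>l w. G z (seg \<sigma> l) w = Some 0))"
proof -
  obtain p where p: "\<And>z. run p (enc z) = map_option enc (G (fst z) (fst (snd z)) (snd (snd z)))"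
    using assms unfolding pcomp_def by blast
  \<comment> \<open>The length \<open>Suc c\<close> belongs to the witness with code \<open>c\<close>, so the empty sequence does not meet
      the bar.\<close>
  define stage :: "nat list \<Rightarrow> nat \<times> 'b \<times> nat" where "stage s = dec (length s - 1)" for s
  define D where "D z s \<longleftrightarrow> s \<noteq> [] \<and>
      computes_in (snd (snd (stage s))) (index p)
        (enc (z, take (fst (stage s)) s, fst (snd (stage s)))) 0" for z :: 'a and s
  have G: "G z s w = Some 0 \<longleftrightarrow> (\<exists>t. computes_in t (index p) (enc (z, s, w)) 0)" for z s w
    using p[of "(z, s, w)"] by (simp add: phi_normal_form[symmetric] phi_index)
  have "dcomp (\<lambda>z. D (fst z) (snd z))"
    unfolding D_def stage_def
    by (intro comp_intros dcomp_computes_in tcomp_dec tcomp_enc tcomp_diff_1 tcomp_length tcomp_take)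
  moreover have "(\<exists>n. D z (seg \<sigma> n)) \<longleftrightarrow> (\<exists>l w. G z (seg \<sigma> l) w = Some 0)" for z \<sigma>
  proof
    assume "\<exists>n. D z (seg \<sigma> n)"
    then obtain n where n: "D z (seg \<sigma> n)" by blast
    obtain l w t where st: "stage (seg \<sigma> n) = (l, w, t)" by (metis prod_cases3)
    have "enc (l, w, t) = n - 1" using st unfolding stage_def by (metis enc_dec seg_simps(2))
    then have "l \<le> n" using le_prod_encode_1[of l "enc (w, t)"] by (simp add: enc_prod_def)
    then have "computes_in t (index p) (enc (z, seg \<sigma> l, w)) 0"
      using n st by (simp add: D_def take_seg)
    then show "\<exists>l w. G z (seg \<sigma> l) w = Some 0" using G by blast
  next
    assume "\<exists>l w. G z (seg \<sigma> l) w = Some 0"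
    then obtain l w where "G z (seg \<sigma> l) w = Some 0" by blast
    then obtain t where t: "computes_in t (index p) (enc (z, seg \<sigma> l, w)) 0" unfolding G by blast
    let ?n = "Suc (enc (l, w, t))"
    have "stage (seg \<sigma> ?n) = (l, w, t)" by (simp add: stage_def)
    moreover have "l \<le> ?n" using le_prod_encode_1[of l "enc (w, t)"] by (simp add: enc_prod_def)
    moreover have "seg \<sigma> ?n \<noteq> []" by (simp add: seg_Suc)
    ultimately have "D z (seg \<sigma> ?n)" using t by (simp add: D_def take_seg)
    then show "\<exists>n. D z (seg \<sigma> n)" by blast
  qed
  moreover have "\<not> D z []" for z by (simp add: D_def)
  ultimately show ?thesis by blast
qed

context K1_combinators
begin

section \<open>Pitts' operator as a game\<close>

text \<open>Elements of \<open>J P\<close> are winning positions. At a node with index \<open>a\<close> the first player names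
  \<open>n\<close>, the opponent answers \<open>k \<ge> n\<close>, and the game moves on to \<open>phi a k\<close>. The first player wins at
  leaves with a result in \<open>P\<close>. A strategy of the opponent maps (the code of) a position and a
  number \<open>n\<close> to the excess \<open>k - n\<close>. Only a finite segment \<open>s\<close> of it is given here, and moves
  beyond that segment are undefined, so that plays persist when the segment grows.\<close>

definition move :: "nat list \<Rightarrow> nat \<Rightarrow> nat \<Rightarrow> nat option"
  where "move s x n = Option.bind (unpair x) (\<lambda>ta.
     if fst ta = Suc 0 \<and> prod_encode (x, n) < length s
     then phi (snd ta) (n + s ! prod_encode (x, n)) else None)"

definition play :: "nat list \<Rightarrow> nat \<Rightarrow> nat list \<Rightarrow> nat option"
  where "play s x ns = pfold (move s) (Some x) ns"

lemma move_eq_Some: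
  "move s x n = Some y \<longleftrightarrow> (\<exists>a. x = pr (Suc 0) a \<and> prod_encode (x, n) < length s \<and>
     phi a (n + s ! prod_encode (x, n)) = Some y)"
  by (auto simp: move_def bind_eq_Some_conv unpair_eq_Some)

lemma play_simps [simp]:
  "play s x [] = Some x" "play s x (n # ns) = Option.bind (move s x n) (\<lambda>y. play s y ns)"
  by (cases "move s x n"; simp add: play_def)+

lemma play_mono:
  "play (seg \<sigma> l) x ns = Some y \<Longrightarrow> l \<le> l' \<Longrightarrow> play (seg \<sigma> l') x ns = Some y"
proof (induction ns arbitrary: x)
  case (Cons n ns)
  then obtain x' where "move (seg \<sigma> l) x n = Some x'" "play (seg \<sigma> l) x' ns = Some y"
    by (auto simp: bind_eq_Some_conv)
  moreover from this have "move (seg \<sigma> l') x n = Some x'"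
    using Cons.prems(2) by (auto simp: move_eq_Some)
  ultimately show ?case using Cons by simp
qed simp

text \<open>A win takes finitely many moves and thus depends on a finite segment of the strategy.\<close>

lemma J_wins:
  "J P x \<Longrightarrow> \<exists>l ns m. play (seg \<sigma> l) x ns = Some (pr 0 m) \<and> m \<in> P"
proof (induction rule: J.induct)
  case (leaf m)
  then show ?case by (intro exI[of _ 0] exI[of _ "[]"] exI[of _ m]) simp
next
  case (node n a)
  let ?q = "prod_encode (pr (Suc 0) a, n)"
  obtain y l ns m where y: "phi a (n + \<sigma> ?q) = Some y"
    "play (seg \<sigma> l) y ns = Some (pr 0 m)" "m \<in> P"
    using node[of "n + \<sigma> ?q"] by auto
  let ?l = "max l (Suc ?q)"
  have "move (seg \<sigma> ?l) (pr (Suc 0) a) n = Some y"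
    using y(1) by (simp add: move_eq_Some)
  moreover have "play (seg \<sigma> ?l) y ns = Some (pr 0 m)" using y(2) by (rule play_mono) simp
  ultimately show ?case using y(3)
    by (intro exI[of _ ?l] exI[of _ "n # ns"] exI[of _ m]) simp
qed

text \<open>If all answers at a node from some \<open>n\<close> on led into \<open>J P\<close>, the node would belong to \<open>J P\<close>. So
  outside \<open>J P\<close> there always is an answer that is undefined or leads outside \<open>J P\<close> again.\<close>

lemma not_J_avoids:
  assumes "\<not> J P x"
  shows "\<exists>\<sigma>. \<forall>l ns m. play (seg \<sigma> l) x ns = Some (pr 0 m) \<longrightarrow> m \<notin> P"
proof -
  \<comment> \<open>As an answer to the choice that \<open>q\<close> codes, \<open>d\<close> keeps the game outside \<open>J P\<close>.\<close>
  define bad where "bad q d \<longleftrightarrow> (\<forall>a. fst (prod_decode q) = pr (Suc 0) a \<longrightarrow>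
      \<not> yields P (phi a (snd (prod_decode q) + d)))" for q d
  define \<sigma> where "\<sigma> q = (SOME d. bad q d)" for q
  have move: "\<not> J P y" if mv: "move (seg \<sigma> l) x n = Some y" and x: "\<not> J P x" for l x n y
  proof -
    let ?q = "prod_encode (x, n)"
    obtain a where a: "x = pr (Suc 0) a" "?q < l" "phi a (n + \<sigma> ?q) = Some y"
      using mv by (auto simp: move_eq_Some)
    have "\<exists>d. \<not> yields P (phi a (n + d))"
    proof (rule ccontr)
      assume *: "\<not> ?thesis"
      have "\<exists>y. phi a k = Some y \<and> J P y" if "n \<le> k" for k
      proof -
        have "yields P (phi a (n + (k - n)))" using * by blast
        then show ?thesis using that by (simp add: yields_def)
      qed
      then have "J P x" unfolding a(1) by (rule node)
      then show False using x by simp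
    qed
    then have "\<exists>d. bad ?q d" by (simp add: bad_def a(1))
    then have "bad ?q (\<sigma> ?q)" unfolding \<sigma>_def by (rule someI_ex)
    then show ?thesis using a by (simp add: bad_def)
  qed
  have "\<not> J P y" if "play (seg \<sigma> l) x ns = Some y" "\<not> J P x" for l x ns y
    using that
  proof (induction ns arbitrary: x)
    case (Cons n ns)
    from Cons.prems(1) obtain x' where "move (seg \<sigma> l) x n = Some x'" "play (seg \<sigma> l) x' ns = Some y"
      by (auto simp: bind_eq_Some_conv)
    then show ?case using Cons.IH move Cons.prems(2) by blast
  qed simp
  then show ?thesis using assms by (intro exI[of _ \<sigma>]) fastforce
qed

lemma pcomp_play:
  assumes "tcomp f" "tcomp g" "tcomp h"
  shows "pcomp (\<lambda>x. play (f x) (g x) (h x))"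
proof -
  have "tcomp (\<lambda>z :: nat list \<times> nat. snd z)" "tcomp (\<lambda>z :: nat list \<times> nat. fst z)"
    by (intro comp_intros)+
  then obtain nth' :: "nat list \<times> nat \<Rightarrow> nat" where nth': "tcomp nth'"
    "\<And>z. snd z < length (fst z) \<Longrightarrow> nth' z = fst z ! snd z"
    by (rule tcomp_nth) (rule that)
  have "move s x n = Option.bind (unpair x) (\<lambda>ta.
     if fst ta = Suc 0 \<and> prod_encode (x, n) < length s
     then phi (snd ta) (n + nth' (s, prod_encode (x, n))) else None)" for s x n
    using nth'(2)[of "(s, prod_encode (x, n))"] unfolding move_def by (cases "unpair x") auto
  then have mv: "pcomp (\<lambda>z. move (fst z) (fst (snd z)) (snd (snd z)))"
    by (simp only:) (intro pcomp_phi pcomp_unpair tcomp_length tcomp_comp[OF nth'(1)] comp_intros)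
  have "pcomp (\<lambda>z :: nat list \<times> nat \<times> nat list. play (fst z) (fst (snd z)) (snd (snd z)))"
    unfolding play_def by (intro pcomp_pfold pcomp_comp3[OF mv] comp_intros)
  then show ?thesis using assms by (rule pcomp_comp3)
qed

section \<open>Comparing trees with the functional E\<close>

text \<open>Think of \<open>D1 z\<close> and \<open>D2 z\<close> as two trees, of the sequences that have not yet met the bar. Two
  players append entries to sequences in the first and the second tree, by turns. A player loses
  as soon as the own sequence meets its bar. If one of the trees is well-founded then every play
  ends, and a player who has an infinite branch wins by following it.

  A position has the value 0 if the player to move wins and 1 otherwise. So its value is
  \<^const>\<open>functional_E\<close> of the map \<open>i \<mapsto> 1 - v\<^sub>i\<close>, where \<open>v\<^sub>i\<close> is the value after the
  move \<open>i\<close>: this is 0 iff some move leads to a position that is lost for the opponent. The values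
  are obtained by bar induction. As \<^const>\<open>functional_E\<close> applies to total maps only, the
  induction must also provide values of the positions off the winning branch.\<close>

lemma compare_trees:
  fixes D1 D2 :: "'z::numbered \<Rightarrow> nat list \<Rightarrow> bool"
  assumes D1: "dcomp (\<lambda>z. D1 (fst z) (snd z))" "\<And>z. \<not> D1 z []"
    and D2: "dcomp (\<lambda>z. D2 (fst z) (snd z))" "\<And>z. \<not> D2 z []"
  shows "\<exists>idx. tcomp idx \<and>
    (\<forall>z. (\<forall>\<sigma>. \<exists>n. D1 z (seg \<sigma> n)) \<longrightarrow> (\<exists>\<tau>. \<forall>n. \<not> D2 z (seg \<tau> n)) \<longrightarrow> (idx z, 1) \<in> E_graph) \<and>
    (\<forall>z. (\<forall>\<tau>. \<exists>n. D2 z (seg \<tau> n)) \<longrightarrow> (\<exists>\<sigma>. \<forall>n. \<not> D1 z (seg \<sigma> n)) \<longrightarrow> (idx z, 0) \<in> E_graph)"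
proof -
  define H :: "nat \<times> 'z \<times> nat list \<times> nat list \<Rightarrow> nat \<Rightarrow> nat option"
    where "H p y = ev (fst p) (snd p, y)" for p y
  have "pcomp (\<lambda>z. H (fst z) (snd z))" unfolding H_def by (intro pcomp_ev comp_intros)
  then obtain S where S: "tcomp S" "\<And>p y. ev (S p) y = H p y"
    by (rule parametrization) (rule that)
  \<comment> \<open>In a position \<open>(z, s, t)\<close> the player to move owns \<open>s\<close>, so the move \<open>i\<close> leads to
      \<open>(z, t, s @ [i])\<close>. The lengths agree when the first player is to move, and only then are
      the bars checked. The input consists of \<open>i\<close> and, after a query about the new position, its
      value.\<close>
  define F :: "nat \<Rightarrow> ('z \<times> nat list \<times> nat list) \<times> nat \<Rightarrow> nat option"
    where "F e x = Option.bind (untup (snd x)) (\<lambda>l.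
      if tl l = [] then
        (if length (snd (snd (fst x))) = length (fst (snd (fst x)) @ [head l]) \<and>
            D1 (fst (fst x)) (snd (snd (fst x))) then Some (pr (truth C) 0)
         else if length (snd (snd (fst x))) = length (fst (snd (fst x)) @ [head l]) \<and>
            D2 (fst (fst x)) (fst (snd (fst x)) @ [head l]) then Some (pr (truth C) 1)
         else Some (pr (falsity C)
           (S (e, fst (fst x), snd (snd (fst x)), fst (snd (fst x)) @ [head l]))))
      else Some (pr (truth C) (1 - head (tl l))))" for e x
  have "pcomp (\<lambda>z. F (fst z) (snd z))"
    unfolding F_def
    by (intro pcomp_untup tcomp_pr tcomp_length tcomp_snoc tcomp_comp[OF S(1)]
        dcomp_comp2[OF D1(1)]
        dcomp_comp2[OF D2(1)]
        comp_intros)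
  then obtain e where e: "\<And>x. ev e x = F e x" by (rule recursion_theorem) (rule that)
  define node where "node z s t = S (e, z, s, t)" for z s t
  have node: "phi (node z s t) y = F e ((z, s, t), y)" for z s t y
    by (simp add: node_def S(2)[unfolded ev_nat] H_def e)
  \<comment> \<open>The value of a position, decided by the bars or else given by the functional.\<close>
  define val where "val z s t v \<longleftrightarrow>
      (if length s = length t \<and> D1 z s then v = 1
       else if length s = length t \<and> D2 z t then v = 0
       else (node z s t, v) \<in> E_graph)" for z s t and v :: nat
  have answer: "oracle_result K1 C E_graph (node z s t) i (1 - v)" if vl: "val z t (s @ [i]) v" for z s t i v
  proof -
    consider "length t = length (s @ [i])" "D1 z t" "v = 1"
      | "length t = length (s @ [i])" "\<not> D1 z t" "D2 z (s @ [i])" "v = 0"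
      | "\<not> (length t = length (s @ [i]) \<and> D1 z t)" "\<not> (length t = length (s @ [i]) \<and> D2 z (s @ [i]))"
        "(node z t (s @ [i]), v) \<in> E_graph"
      using vl unfolding val_def by (auto split: if_splits)
    then show ?thesis
    proof cases
      case 1
      then show ?thesis unfolding oracle_result_iff dialogue_iff
        by (intro exI[of _ "[]"]) (simp add: node F_def)
    next
      case 2
      then show ?thesis unfolding oracle_result_iff dialogue_iff
        by (intro exI[of _ "[]"]) (simp add: node F_def)
    next
      case 3
      have "phi (node z s t) (tup [i]) = Some (pr (falsity C) (node z t (s @ [i])))"
        using 3(1,2) unfolding node F_def by (auto simp: node_def)
      moreover have "phi (node z s t) (tup [i, v]) = Some (pr (truth C) (1 - v))"
        unfolding node F_def by simp
      ultimately show ?thesis using 3(3) unfolding oracle_result_iff dialogue_iff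
        by (intro exI[of _ "[v]"]) simp
    qed
  qed
  have one_move: "(node z s t, functional_E (\<lambda>i. 1 - V i)) \<in> E_graph"
    if "\<And>i. val z t (s @ [i]) (V i)" for z s t V
    using that by (intro E_graph_I answer)
  have two_moves: "(node z s t, if \<exists>i. \<forall>j. V i j = 0 then 0 else 1) \<in> E_graph"
    if len: "length s = length t" and V: "\<And>i j. val z (s @ [i]) (t @ [j]) (V i j)"
    for z s t and V :: "nat \<Rightarrow> nat \<Rightarrow> nat"
  proof -
    \<comment> \<open>The second player wins after the move \<open>i\<close> iff some answer \<open>j\<close> leads to a value other than 0.\<close>
    let ?U = "\<lambda>i. functional_E (\<lambda>j. 1 - V i j)"
    have "(node z t (s @ [i]), ?U i) \<in> E_graph" for i
      using V by (intro one_move)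
    then have "val z t (s @ [i]) (?U i)" for i using len by (simp add: val_def)
    then have "(node z s t, functional_E (\<lambda>i. 1 - ?U i)) \<in> E_graph" by (rule one_move)
    moreover have "functional_E (\<lambda>i. 1 - ?U i) = (if \<exists>i. \<forall>j. V i j = 0 then 0 else 1)"
      unfolding functional_E_def by (auto simp: not_le)
    ultimately show ?thesis by simp
  qed
  have root: "(node z [] [], v) \<in> E_graph" if "val z [] [] v" for z v
    using that D1(2) D2(2) by (simp add: val_def)
  have first: "(node z [] [], 1) \<in> E_graph"
    if bar: "\<And>\<sigma>. \<exists>n. D1 z (seg \<sigma> n)" and avoid: "\<And>n. \<not> D2 z (seg \<tau> n)" for z \<tau>
  proof -
    have "\<forall>t. length t = length s \<longrightarrow>
        (\<exists>v. val z s t v \<and> (t = seg \<tau> (length s) \<longrightarrow> v = 1))" (is "?P s")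
      if s: "s = []" for s
      unfolding s
    proof (rule bar_induction[where D = "D1 z"])
      show "\<exists>n. D1 z (seg \<sigma> n)" for \<sigma> by (rule bar)
      show "?P s" if "D1 z s" for s using that by (simp add: val_def)
      fix s assume IH: "\<And>i. ?P (s @ [i])"
      show "?P s"
      proof (intro allI impI)
        fix t :: "nat list" assume len: "length t = length s"
        have "\<exists>v. val z (s @ [i]) (t @ [j]) v \<and> (t @ [j] = seg \<tau> (Suc (length s)) \<longrightarrow> v = 1)" for i j
          using IH[of i, rule_format, of "t @ [j]"] len by simp
        then obtain V where V: "\<And>i j. val z (s @ [i]) (t @ [j]) (V i j)"
          "\<And>i j. t @ [j] = seg \<tau> (Suc (length s)) \<Longrightarrow> V i j = 1" by metis
        have G: "(node z s t, if \<exists>i. \<forall>j. V i j = 0 then 0 else 1) \<in> E_graph"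
          using len V(1) by (intro two_moves) simp_all
        consider "D1 z s" | "\<not> D1 z s" "D2 z t" | "\<not> D1 z s" "\<not> D2 z t" by blast
        then show "\<exists>v. val z s t v \<and> (t = seg \<tau> (length s) \<longrightarrow> v = 1)"
        proof cases
          case 3
          then have "val z s t (if \<exists>i. \<forall>j. V i j = 0 then 0 else 1)" using G by (simp add: val_def)
          moreover have "(if \<exists>i. \<forall>j. V i j = 0 then 0 else 1) = (1 :: nat)" if "t = seg \<tau> (length s)"
          proof -
            have "V i (\<tau> (length s)) = 1" for i using V(2) that by (simp add: seg_Suc)
            then have "\<not> (\<exists>i. \<forall>j. V i j = 0)" by (metis zero_neq_one)
            then show ?thesis by (rule if_not_P)
          qed
          ultimately show ?thesis by blast
        qed (use avoid len in \<open>auto simp: val_def\<close>)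
      qed
    qed
    then show ?thesis using root by force
  qed
  have second: "(node z [] [], 0) \<in> E_graph"
    if bar: "\<And>\<tau>. \<exists>n. D2 z (seg \<tau> n)" and avoid: "\<And>n. \<not> D1 z (seg \<sigma> n)" for z \<sigma>
  proof -
    have "\<forall>s. length s = length t \<longrightarrow>
        (\<exists>v. val z s t v \<and> (s = seg \<sigma> (length t) \<longrightarrow> v = 0))" (is "?P t")
      if t: "t = []" for t
      unfolding t
    proof (rule bar_induction[where D = "D2 z"])
      show "\<exists>n. D2 z (seg \<tau> n)" for \<tau> by (rule bar)
      show "?P t" if "D2 z t" for t
      proof (intro allI impI)
        fix s :: "nat list" assume "length s = length t"
        then show "\<exists>v. val z s t v \<and> (s = seg \<sigma> (length t) \<longrightarrow> v = 0)"
          using that avoid by (cases "D1 z s") (auto simp: val_def)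
      qed
      fix t assume IH: "\<And>j. ?P (t @ [j])"
      show "?P t"
      proof (intro allI impI)
        fix s :: "nat list" assume len: "length s = length t"
        have "\<exists>v. val z (s @ [i]) (t @ [j]) v \<and> (s @ [i] = seg \<sigma> (Suc (length t)) \<longrightarrow> v = 0)" for i j
          using IH[of j, rule_format, of "s @ [i]"] len by simp
        then obtain V where V: "\<And>i j. val z (s @ [i]) (t @ [j]) (V i j)"
          "\<And>i j. s @ [i] = seg \<sigma> (Suc (length t)) \<Longrightarrow> V i j = 0" by metis
        have G: "(node z s t, if \<exists>i. \<forall>j. V i j = 0 then 0 else 1) \<in> E_graph"
          using len V(1) by (intro two_moves) simp_all
        consider "D1 z s" | "\<not> D1 z s" "D2 z t" | "\<not> D1 z s" "\<not> D2 z t" by blast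
        then show "\<exists>v. val z s t v \<and> (s = seg \<sigma> (length t) \<longrightarrow> v = 0)"
        proof cases
          case 3
          then have "val z s t (if \<exists>i. \<forall>j. V i j = 0 then 0 else 1)" using G by (simp add: val_def)
          moreover have "(if \<exists>i. \<forall>j. V i j = 0 then 0 else 1) = (0 :: nat)" if "s = seg \<sigma> (length t)"
          proof -
            have "V (\<sigma> (length t)) j = 0" for j using V(2) that by (simp add: seg_Suc)
            then have "\<exists>i. \<forall>j. V i j = 0" by blast
            then show ?thesis by (rule if_P)
          qed
          ultimately show ?thesis by blast
        qed (use avoid len in \<open>auto simp: val_def\<close>)
      qed
    qed
    then show ?thesis using root by force
  qed
  have "tcomp (\<lambda>z. node z [] [])"
    unfolding node_def by (intro tcomp_comp[OF S(1)] comp_intros)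
  then show ?thesis using first second by blast
qed

text \<open>The infinite branches of the tree are the strategies against which no play from \<open>phi e n\<close>
  reaches a leaf with a result \<open>m\<close> satisfying \<open>A m j\<close>.\<close>

lemma ex_value_bar:
  fixes A :: "nat \<Rightarrow> nat \<Rightarrow> bool"
  assumes "dcomp (\<lambda>z. A (fst z) (snd z))"
  shows "\<exists>D. dcomp (\<lambda>z. D (fst z) (snd z)) \<and> (\<forall>z. \<not> D z []) \<and>
    (\<forall>e n j x. phi e n = Some x \<longrightarrow>
      (J {m. A m j} x \<longrightarrow> (\<forall>\<sigma>. \<exists>k. D (e, n, j) (seg \<sigma> k))) \<and>
      (\<not> J {m. A m j} x \<longrightarrow> (\<exists>\<sigma>. \<forall>k. \<not> D (e, n, j) (seg \<sigma> k))))"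
proof -
  define G :: "nat \<times> nat \<times> nat \<Rightarrow> nat list \<Rightarrow> nat list \<Rightarrow> nat option"
    where "G z s ns = Option.bind (phi (fst z) (fst (snd z))) (\<lambda>x.
      Option.bind (play s x ns) (\<lambda>y. Option.bind (unpair y) (\<lambda>tm.
        if fst tm = 0 \<and> A (snd tm) (snd (snd z)) then Some 0 else None)))" for z s ns
  have "pcomp (\<lambda>z. G (fst z) (fst (snd z)) (snd (snd z)))"
    unfolding G_def by (intro pcomp_phi pcomp_play pcomp_unpair dcomp_comp2[OF assms] comp_intros)
  from decidable_bar[OF this] obtain D where D: "dcomp (\<lambda>z. D (fst z) (snd z))" "\<forall>z. \<not> D z []"
    "\<And>z \<sigma>. (\<exists>k. D z (seg \<sigma> k)) \<longleftrightarrow> (\<exists>l w. G z (seg \<sigma> l) w = Some 0)"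
    by blast
  have G: "(\<exists>l w. G (e, n, j) (seg \<sigma> l) w = Some 0) \<longleftrightarrow>
      (\<exists>l ns m. play (seg \<sigma> l) x ns = Some (pr 0 m) \<and> m \<in> {m. A m j})"
    if "phi e n = Some x" for e n j x \<sigma>
    using that by (auto simp: G_def bind_eq_Some_conv unpair_eq_Some)
  show ?thesis
  proof (intro exI[of _ D] conjI allI impI)
    show "dcomp (\<lambda>z. D (fst z) (snd z))" by (rule D(1))
    show "\<not> D z []" for z using D(2) by blast
    fix e n j x assume x: "phi e n = Some x"
    show "\<exists>k. D (e, n, j) (seg \<sigma> k)" if "J {m. A m j} x" for \<sigma>
      unfolding D(3) G[OF x] using that by (rule J_wins)
    assume "\<not> J {m. A m j} x"
    then obtain \<sigma> where
      "\<forall>l ns m. play (seg \<sigma> l) x ns = Some (pr 0 m) \<longrightarrow> m \<notin> {m. A m j}"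
      using not_J_avoids by blast
    then have "\<not> (\<exists>k. D (e, n, j) (seg \<sigma> k))" unfolding D(3) G[OF x] by blast
    then show "\<exists>\<sigma>. \<forall>k. \<not> D (e, n, j) (seg \<sigma> k)" by blast
  qed
qed

text \<open>A tree with result \<open>m\<close> belongs to exactly one of \<open>J {i. j < i}\<close> and \<open>J {i. i \<le> j}\<close>, so
  comparing the trees of opposing strategies tells whether \<open>m \<le> j\<close>. A dialogue asks this for
  \<open>j = 0, 1, \<dots>\<close> until the reply is 0.\<close>

lemma ex_K1_E_index:
  "\<exists>hat. tcomp hat \<and> (\<forall>e n m. J1 C e n = Some m \<longrightarrow> K1_E C (hat e) n = Some m)"
proof -
  have "dcomp (\<lambda>z :: nat \<times> nat. snd z < fst z)" by (intro comp_intros)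
  from ex_value_bar[of "\<lambda>m j. j < m", OF this] obtain D1 where D1: "dcomp (\<lambda>z. D1 (fst z) (snd z))" "\<And>z. \<not> D1 z []"
    "\<And>e n j x. phi e n = Some x \<Longrightarrow> J {m. j < m} x \<Longrightarrow> \<forall>\<sigma>. \<exists>k. D1 (e, n, j) (seg \<sigma> k)"
    "\<And>e n j x. phi e n = Some x \<Longrightarrow> \<not> J {m. j < m} x \<Longrightarrow> \<exists>\<sigma>. \<forall>k. \<not> D1 (e, n, j) (seg \<sigma> k)"
    by blast
  have "dcomp (\<lambda>z :: nat \<times> nat. fst z \<le> snd z)" by (intro comp_intros)
  from ex_value_bar[of "\<lambda>m j. m \<le> j", OF this] obtain D2 where D2: "dcomp (\<lambda>z. D2 (fst z) (snd z))" "\<And>z. \<not> D2 z []"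
    "\<And>e n j x. phi e n = Some x \<Longrightarrow> J {m. m \<le> j} x \<Longrightarrow> \<forall>\<sigma>. \<exists>k. D2 (e, n, j) (seg \<sigma> k)"
    "\<And>e n j x. phi e n = Some x \<Longrightarrow> \<not> J {m. m \<le> j} x \<Longrightarrow> \<exists>\<sigma>. \<forall>k. \<not> D2 (e, n, j) (seg \<sigma> k)"
    by blast
  obtain idx where idx: "tcomp idx"
    "\<And>z. \<forall>\<sigma>. \<exists>k. D1 z (seg \<sigma> k) \<Longrightarrow> \<exists>\<tau>. \<forall>k. \<not> D2 z (seg \<tau> k) \<Longrightarrow> (idx z, 1) \<in> E_graph"
    "\<And>z. \<forall>\<tau>. \<exists>k. D2 z (seg \<tau> k) \<Longrightarrow> \<exists>\<sigma>. \<forall>k. \<not> D1 z (seg \<sigma> k) \<Longrightarrow> (idx z, 0) \<in> E_graph"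
    using compare_trees[OF D1(1,2) D2(1,2)] by blast
  \<comment> \<open>The number \<open>Suc 0\<close> in front of the replies stands for a last reply before the first query.\<close>
  define H :: "nat \<Rightarrow> nat \<Rightarrow> nat option"
    where "H e y = Option.bind (untup y) (\<lambda>l.
      if head (rev (Suc 0 # tl l)) = 0 then Some (pr (truth C) (length (tl l) - 1))
      else Some (pr (falsity C) (idx (e, head l, length (tl l)))))" for e y
  have "pcomp (\<lambda>z. H (fst z) (snd z))"
    unfolding H_def
    by (intro pcomp_untup tcomp_pr tcomp_length tcomp_rev tcomp_diff_1 tcomp_comp[OF idx(1)] comp_intros)
  then obtain hat where hat: "tcomp hat" "\<And>e y. ev (hat e) y = H e y"
    by (rule parametrization) (rule that)
  have "K1_E C (hat e) n = Some m" if J1: "J1 C e n = Some m" for e n m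
  proof -
    obtain x where x: "phi e n = Some x" "J {m} x"
      using J1 by (auto simp: J1_eq_Some yields_def)
    have greater: "(idx (e, n, j), 1) \<in> E_graph" if "j < m" for j
    proof (rule idx(2))
      have "J {m. j < m} x" using that by (intro J_mono[OF x(2)]) simp
      then show "\<forall>\<sigma>. \<exists>k. D1 (e, n, j) (seg \<sigma> k)" by (rule D1(3)[OF x(1)])
      have "\<not> J {m. m \<le> j} x" using J_meet[OF x(2)] that by force
      then show "\<exists>\<tau>. \<forall>k. \<not> D2 (e, n, j) (seg \<tau> k)" by (rule D2(4)[OF x(1)])
    qed
    have equal: "(idx (e, n, m), 0) \<in> E_graph"
    proof (rule idx(3))
      have "J {m'. m' \<le> m} x" by (intro J_mono[OF x(2)]) simp
      then show "\<forall>\<sigma>. \<exists>k. D2 (e, n, m) (seg \<sigma> k)" by (rule D2(3)[OF x(1)])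
      have "\<not> J {m'. m < m'} x" using J_meet[OF x(2)] by force
      then show "\<exists>\<sigma>. \<forall>k. \<not> D1 (e, n, m) (seg \<sigma> k)" by (rule D1(4)[OF x(1)])
    qed
    \<comment> \<open>The replies are 1 for \<open>j < m\<close> and 0 for \<open>j = m\<close>.\<close>
    let ?u = "replicate m (Suc 0) @ [0]"
    have ones: "head (replicate i (Suc 0) @ [Suc 0]) = Suc 0" for i
      by (simp add: replicate_append_same)
    have "dialogue K1 C E_graph (hat e) n ?u"
      unfolding dialogue_iff
    proof (intro allI impI)
      fix i assume i: "i < length ?u"
      then have "take i ?u = replicate i (Suc 0)" by (simp add: min_def)
      then have "phi (hat e) (tup (n # take i ?u)) = Some (pr (falsity C) (idx (e, n, i)))"
        using ones[of i] by (simp add: hat(2)[unfolded ev_nat] H_def)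
      moreover have "(idx (e, n, i), ?u ! i) \<in> E_graph"
        using i greater equal by (cases "i = m") (simp_all add: nth_append)
      ultimately show "\<exists>v. phi (hat e) (tup (n # take i ?u)) = Some (pr (falsity C) v) \<and> (v, ?u ! i) \<in> E_graph"
        by blast
    qed
    moreover have "phi (hat e) (tup (n # ?u)) = Some (pr (truth C) m)"
      by (simp add: hat(2)[unfolded ev_nat] H_def)
    ultimately show ?thesis unfolding K1_E_eq_Some oracle_result_iff by blast
  qed
  then show ?thesis using hat(1) by blast
qed

section \<open>The isomorphism\<close>

text \<open>Substitution for an application \<open>M\<close> whose values are trees, by sequencing the trees of
  \<open>b c\<close>, \<open>a c\<close> and \<open>a c (b c)\<close>. The instance \<open>M = phi\<close> serves \<^const>\<open>J1\<close>, and the evaluation of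
  dialogues serves \<^const>\<open>K1_E\<close>.\<close>

lemma J_substitution:
  assumes M: "pcomp (\<lambda>z. M (fst z) (snd z))"
  shows "\<exists>q. tcomp (\<lambda>z. q (fst z) (snd z)) \<and>
     (\<forall>a b c x y v. yields {x} (M a c) \<longrightarrow> yields {y} (M b c) \<longrightarrow> yields {v} (M x y) \<longrightarrow> yields {v} (phi (q a b) c))"
proof -
  obtain B where B: "binds B" using ex_binds by blast
  from M obtain S1 where S1: "tcomp S1" "\<And>x y. ev (S1 x) y = M x y"
    by (rule parametrization) (rule that)
  have "pcomp (\<lambda>z. (\<lambda>y x. B y (S1 x)) (fst z) (snd z))"
    by (intro pcomp_binds[OF B] tcomp_comp[OF S1(1)] comp_intros)
  then obtain S2 where S2: "tcomp S2" "\<And>y x. ev (S2 y) x = B y (S1 x)"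
    by (rule parametrization) (rule that)
  define H :: "nat \<times> nat \<Rightarrow> nat \<Rightarrow> nat option"
    where "H p c = Option.bind (M (snd p) c) (\<lambda>y. Option.bind (M (fst p) c) (\<lambda>x. B x (S2 y)))" for p c
  have "pcomp (\<lambda>z. H (fst z) (snd z))"
    unfolding H_def by (intro pcomp_comp2[OF M] pcomp_binds[OF B] tcomp_comp[OF S2(1)] comp_intros)
  then obtain S3 where S3: "tcomp S3" "\<And>p c. ev (S3 p) c = H p c"
    by (rule parametrization) (rule that)
  have "yields {v} (phi (S3 (a, b)) c)"
    if x: "yields {x} (M a c)" and y: "yields {y} (M b c)" and v: "yields {v} (M x y)" for a b c x y v
  proof -
    obtain y' where y': "M b c = Some y'" "yields {y} (Some y')" using y by (auto simp: yields_def)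
    have "yields {v} (phi (S1 x) y)" using v by (simp add: S1(2)[unfolded ev_nat])
    then have "yields {v} (Option.bind (Some y') (\<lambda>y. B y (S1 x)))"
      by (intro bind_step[OF B y'(2)]) simp
    then have "yields {v} (phi (S2 y') x)" by (simp add: S2(2)[unfolded ev_nat])
    then have "yields {v} (Option.bind (M a c) (\<lambda>x. B x (S2 y')))"
      by (intro bind_step[OF B x]) simp
    then show ?thesis by (simp add: S3(2)[unfolded ev_nat] H_def y'(1))
  qed
  moreover have "tcomp (\<lambda>z. S3 (fst z, snd z))" by (intro tcomp_comp[OF S3(1)] comp_intros)
  ultimately show ?thesis by (intro exI[of _ "\<lambda>a b. S3 (a, b)"]) blast
qed

lemma J1_represents:
  fixes f :: "nat \<Rightarrow> nat"
  assumes "tcomp f" shows "\<exists>e. \<forall>a. J1 C e a = Some (f a)"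
proof -
  have "pcomp (\<lambda>z :: nat \<times> nat. Some (pr 0 (f (snd z))))"
    by (intro tcomp_pr tcomp_comp[OF assms] comp_intros)
  then obtain S where S: "\<And>(n :: nat) a. ev (S n) a = Some (pr 0 (f a))"
    by (rule parametrization[where F = "\<lambda>n a. Some (pr 0 (f a))"]) (rule that)
  show ?thesis by (intro exI[of _ "S 0"]) (simp add: J1_eq_Some S[unfolded ev_nat])
qed

lemma K1_E_parametrization:
  fixes f :: "nat \<Rightarrow> nat \<Rightarrow> nat"
  assumes "tcomp (\<lambda>z. f (fst z) (snd z))"
  shows "\<exists>S. tcomp S \<and> (\<forall>a b. K1_E C (S a) b = Some (f a b))"
proof -
  have "pcomp (\<lambda>z :: nat \<times> nat. Option.bind (untup (snd z)) (\<lambda>l. Some (pr (truth C) (f (fst z) (head l)))))"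
    by (intro pcomp_untup tcomp_pr tcomp_comp2[OF assms] comp_intros)
  then obtain S where S: "tcomp S"
    "\<And>a y. ev (S a) y = Option.bind (untup y) (\<lambda>l. Some (pr (truth C) (f a (head l))))"
    by (rule parametrization[where F = "\<lambda>a y. Option.bind (untup y) (\<lambda>l. Some (pr (truth C) (f a (head l))))"])
      (rule that)
  have "K1_E C (S a) b = Some (f a b)" for a b
    unfolding K1_E_eq_Some oracle_result_iff dialogue_iff
    by (intro exI[of _ "[]"]) (simp add: S(2)[unfolded ev_nat])
  then show ?thesis using S(1) by blast
qed

lemma K1_E_represents:
  fixes f :: "nat \<Rightarrow> nat"
  assumes "tcomp f" shows "\<exists>e. \<forall>a. K1_E C e a = Some (f a)"
proof -
  have "tcomp (\<lambda>z :: nat \<times> nat. f (snd z))" by (intro tcomp_comp[OF assms] comp_intros)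
  then show ?thesis using K1_E_parametrization[of "\<lambda>_. f"] by blast
qed

lemma J1_parametrization:
  fixes f :: "nat \<Rightarrow> nat \<Rightarrow> nat"
  assumes "tcomp (\<lambda>z. f (fst z) (snd z))"
  shows "\<exists>S. tcomp S \<and> (\<forall>a b. J1 C (S a) b = Some (f a b))"
proof -
  have "pcomp (\<lambda>z :: nat \<times> nat. Some (pr 0 (f (fst z) (snd z))))"
    by (intro tcomp_pr assms comp_intros)
  then obtain S where "tcomp S" "\<And>a b. ev (S a) b = Some (pr 0 (f a b))"
    by (rule parametrization[where F = "\<lambda>a b. Some (pr 0 (f a b))"]) (rule that)
  then show ?thesis by (auto simp: J1_eq_Some ev_nat)
qed

lemma is_pca_J1: "is_pca (J1 C)"
proof -
  have "pcomp (\<lambda>z :: nat \<times> nat. phi (fst z) (snd z))" by (intro pcomp_phi comp_intros)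
  from J_substitution[OF this] obtain q where q: "tcomp (\<lambda>z. q (fst z) (snd z))"
    "\<forall>a b c x y v. yields {x} (phi a c) \<longrightarrow> yields {y} (phi b c) \<longrightarrow> yields {v} (phi x y) \<longrightarrow> yields {v} (phi (q a b) c)"
    by blast
  obtain k' where k': "tcomp k'" "\<forall>a b. J1 C (k' a) b = Some a"
    using J1_parametrization[OF tcomp_fst[OF tcomp_id]] by blast
  obtain s' where s': "tcomp s'" "\<forall>a b. J1 C (s' a) b = Some (q a b)"
    using J1_parametrization[OF q(1)] by blast
  obtain k s where "\<forall>a. J1 C k a = Some (k' a)" "\<forall>a. J1 C s a = Some (s' a)"
    using J1_represents[OF k'(1)] J1_represents[OF s'(1)] by blast
  then show ?thesis using k'(2) s'(2) q(2)
    by (intro is_pcaI[of _ k k' s s' q]) (simp_all add: J1_eq_Some)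
qed

text \<open>Instead of joining dialogues, \<open>a c (b c)\<close> is evaluated by a tree, and the index of this
  computation is translated back.\<close>

lemma is_pca_K1_E: "is_pca (K1_E C)"
proof -
  obtain M where M: "pcomp (\<lambda>z. M (fst z) (snd z))"
    "\<forall>a b c. oracle_result K1 C E_graph a b c \<longrightarrow> yields {c} (M a b)"
    using ex_J_evaluation by blast
  obtain q where q: "tcomp (\<lambda>z. q (fst z) (snd z))"
    "\<forall>a b c x y v. yields {x} (M a c) \<longrightarrow> yields {y} (M b c) \<longrightarrow> yields {v} (M x y) \<longrightarrow> yields {v} (phi (q a b) c)"
    using J_substitution[OF M(1)] by blast
  obtain hat where hat: "tcomp hat" "\<forall>e n m. J1 C e n = Some m \<longrightarrow> K1_E C (hat e) n = Some m"
    using ex_K1_E_index by blast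
  obtain k' where k': "tcomp k'" "\<forall>a b. K1_E C (k' a) b = Some a"
    using K1_E_parametrization[OF tcomp_fst[OF tcomp_id]] by blast
  obtain s' where s': "tcomp s'" "\<forall>a b. K1_E C (s' a) b = Some (hat (q a b))"
    using K1_E_parametrization[OF tcomp_comp[OF hat(1) q(1)]] by blast
  obtain k s where "\<forall>a. K1_E C k a = Some (k' a)" "\<forall>a. K1_E C s a = Some (s' a)"
    using K1_E_represents[OF k'(1)] K1_E_represents[OF s'(1)] by blast
  moreover have "K1_E C (hat (q a b)) c = Some v"
    if "K1_E C a c = Some x" "K1_E C b c = Some y" "K1_E C x y = Some v" for a b c x y v
  proof -
    have "yields {v} (phi (q a b) c)" using that M(2) q(2) unfolding K1_E_eq_Some by blast
    then show ?thesis using hat(2) J1_eq_Some by blast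
  qed
  ultimately show ?thesis using k'(2) s'(2)
    by (intro is_pcaI[of _ k k' s s' "\<lambda>a b. hat (q a b)"]) simp_all
qed

lemma J1_to_K1_E: "applicative_morphism (J1 C) (K1_E C) Id"
proof -
  obtain hat where hat: "tcomp hat" "\<forall>e n m. J1 C e n = Some m \<longrightarrow> K1_E C (hat e) n = Some m"
    using ex_K1_E_index by blast
  obtain r where "\<forall>a. K1_E C r a = Some (hat a)" using K1_E_represents[OF hat(1)] by blast
  then show ?thesis using hat(2) unfolding applicative_morphism_def by (auto intro!: exI[of _ r])
qed

lemma K1_E_to_J1: "applicative_morphism (K1_E C) (J1 C) Id"
proof -
  obtain M where M: "pcomp (\<lambda>z. M (fst z) (snd z))"
    "\<forall>a b c. oracle_result K1 C E_graph a b c \<longrightarrow> yields {c} (M a b)"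
    using ex_J_evaluation by blast
  from M(1) obtain S where S: "tcomp S" "\<And>a b. ev (S a) b = M a b"
    by (rule parametrization) (rule that)
  obtain r where "\<forall>a. J1 C r a = Some (S a)" using J1_represents[OF S(1)] by blast
  moreover have "J1 C (S a) b = Some c" if "K1_E C a b = Some c" for a b c
    using that M(2) by (simp add: J1_eq_Some K1_E_eq_Some S(2)[unfolded ev_nat])
  ultimately show ?thesis unfolding applicative_morphism_def by (auto intro!: exI[of _ r])
qed

end

theorem theorem5p10:
  fixes C :: "nat combinators"
  assumes "valid_combinators K1 C"
  shows "pca_isomorphic (J1 C) (K1_E C)"
proof -
  interpret K1_combinators C by unfold_locales (rule assms)
  show ?thesis
    unfolding pca_isomorphic_def
    using is_pca_J1 is_pca_K1_E J1_to_K1_E K1_E_to_J1 by (auto intro!: exI[of _ Id])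
qed

end
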